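(* Let $p_{\mathcal D}$ be a probability distribution on $\mathcal S\times\mathcal A$ with multimodal structure $(\mathsf K(s),C_1(s),\dots,C_{\mathsf K(s)}(s))_{s\in\mathcal S}$, let $q_\phi(\cdot\mid a,s)$ be a posterior encoder, $p_\psi(\cdot\mid s)$ a conditional prior on $\mathbb R^{\mathsf d_z}$, and $f_\theta:\mathbb R^{\mathsf d_z}\times\mathcal S\to\mathcal A$ a deterministic decoder (all as defined in the context). Let $(S,A,Z)\sim q_{\phi,\mathcal D}$ and let $M=g(A,S)$ be the mode label. For each $s\in\mathcal S$ let $$\rho(s):=\Pr\big(f_\theta(Z,s)\notin C_M(s)\,\big|\,S=s\big).$$ Assume that $\rho(s)\le 1-1/\mathsf K(s)$ for all $s\in\operatorname{supp}(p_{\mathcal D,S})$ with $\mathsf K(s)>1$. Then $$I(A;Z\mid S)\ \ge\ B_\rho .$$ Consequently, $$\mathbb E_{(S,A)\sim p_{\mathcal D}}\,\mathrm{KL}\big(q_\phi(\cdot\mid A,S)\,\|\,p_\psi(\cdot\mid S)\big)\ \ge\ B_\rho .$$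
   Context: $\mathcal S$ is a state space and $(\mathcal A,d_{\mathcal A})$ is a metric action space. $p_{\mathcal D}$ is a probability distribution on $\mathcal S\times\mathcal A$ with state marginal $p_{\mathcal D,S}$ and conditional action law $p_{\mathcal D}(\cdot\mid s)$. Multimodal structure: for each $s\in\mathcal S$ there are a natural number $\mathsf K(s)\ge 1$ and sets $C_1(s),\dots,C_{\mathsf K(s)}(s)\subseteq\mathcal A$ (modes) such that $\operatorname{supp}p_{\mathcal D}(\cdot\mid s)\subseteq\bigcup_{k=1}^{\mathsf K(s)}C_k(s)$ and $\Delta(s):=\min_{k\ne k'}\operatorname{dist}_{\mathcal A}(C_k(s),C_{k'}(s))>0$, where $\operatorname{dist}_{\mathcal A}(B,C)=\inf_{b\in B,c\in C}d_{\mathcal A}(b,c)$. In particular the modes are pairwise disjoint. Mode assignment: $g(a,s)=\sum_{k=1}^{\mathsf K(s)}k\,\mathbf 1_{\{a\in C_k(s)\}}$, and $M:=g(A,S)$, so that $M\in\{1,\dots,\mathsf K(S)\}$ almost surely. Latent-variable policy: $q_\phi(\cdot\mid a,s)$ (posterior encoder) and $p_\psi(\cdot\mid s)$ (prior) are conditional probability distributions on $\mathbb R^{\mathsf d_z}$, and the decoder is deterministic, given by a map $f_\theta$: the decoded action at latent $z$ and state $s$ is $f_\theta(z,s)$. All maps, sets and kernels are measurable as needed. The joint law is $q_{\phi,\mathcal D}(s,a,z):=p_{\mathcal D}(s,a)\,q_\phi(z\mid a,s)$, i.e. $(S,A)\sim p_{\mathcal D}$ and $Z\mid (A,S)\sim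 q_\phi(\cdot\mid A,S)$. All probabilities, entropies and mutual informations involving $(S,A,Z)$ are under this law. $I(A;Z\mid S)$ denotes conditional mutual information; logarithms are natural. Fano-corrected bound: for measurable $\rho:\mathcal S\to[0,1]$, $$B_\rho:=\mathbb E_{S\sim p_{\mathcal D,S}}[H(M\mid S)]-\mathbb E_{S\sim p_{\mathcal D,S}}\big[H_b(\rho(S))+\rho(S)\log(\mathsf K(S)-1)\big],$$ where, inside the expectation, $H(M\mid S)$ at $S=s$ is the Shannon entropy of the conditional law of $M$ given $S=s$, $H_b(p)=-p\log p-(1-p)\log(1-p)$ (with $0\log 0=0$), and the bracketed term is taken to be zero when $\mathsf K(S)=1$. The expectations are understood to be such that this difference is well defined. *)

theory Defs
  imports "HOL-Probability.Probability"
begin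

subsection \<open>Topological support of a Borel measure\<close>

definition msupport :: "'x::topological_space measure \<Rightarrow> 'x set" where
  "msupport \<mu> = {x. \<forall>U. open U \<and> x \<in> U \<longrightarrow> emeasure \<mu> U > 0}"

text \<open>A Borel measure on a space without a countable base need not be carried by its support.
  Where the support is meant to carry the measure, this is stated by the next predicate; it
  holds automatically on second countable (in particular separable metric) spaces.\<close>

definition carried_by_support :: "'x::topological_space measure \<Rightarrow> bool" where
  "carried_by_support \<mu> \<longleftrightarrow> (AE x in \<mu>. x \<in> msupport \<mu>)"

lemma carried_by_support_second_countable:
  fixes \<mu> :: "'x::second_countable_topology measure"
  assumes "sets \<mu> = sets borel"
  shows "carried_by_support \<mu>"
proof -
  define F where "F = {U::'x set. open U \<and> emeasure \<mu> U = 0}"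
  obtain F' where F': "F' \<subseteq> F" "countable F'" "\<Union>F' = \<Union>F"
    using Lindelof[of F] by (auto simp: F_def)
  have "\<Union>F' \<in> null_sets \<mu>"
  proof -
    have "(\<Union>U\<in>F'. U) \<in> null_sets \<mu>"
      using F' assms by (intro null_sets_UN') (auto simp: F_def null_sets_def)
    then show ?thesis by simp
  qed
  moreover have "{x \<in> space \<mu>. x \<notin> msupport \<mu>} \<subseteq> \<Union>F'"
    unfolding F' by (auto simp: F_def msupport_def)
  ultimately show ?thesis
    unfolding carried_by_support_def by (rule AE_I')
qed

subsection \<open>Kernels\<close>

text \<open>The law of \<open>(X, Y)\<close> with \<open>X\<close> distributed as \<open>\<mu>\<close> and \<open>Y\<close> given \<open>X = x\<close> distributed
  as \<open>\<kappa> x\<close>; the values of \<open>\<kappa>\<close> are measures on the measurable space \<open>N\<close>.\<close>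

definition semidirect ::
  "'x measure \<Rightarrow> 'y measure \<Rightarrow> ('x \<Rightarrow> 'y measure) \<Rightarrow> ('x \<times> 'y) measure" where
  "semidirect \<mu> N \<kappa> = \<mu> \<bind> (\<lambda>x. distr (\<kappa> x) (\<mu> \<Otimes>\<^sub>M N) (Pair x))"

lemma nn_integral_semidirect:
  assumes \<mu>: "\<mu> \<in> space (prob_algebra L)" and \<kappa>: "\<kappa> \<in> L \<rightarrow>\<^sub>M prob_algebra N"
    and h: "h \<in> borel_measurable (L \<Otimes>\<^sub>M N)"
  shows "(\<integral>\<^sup>+ w. h w \<partial>semidirect \<mu> N \<kappa>) = (\<integral>\<^sup>+ x. \<integral>\<^sup>+ y. h (x, y) \<partial>\<kappa> x \<partial>\<mu>)"
proof -
  have [measurable_cong]: "sets \<mu> = sets L"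
    using \<mu> by (simp add: space_prob_algebra)
  have \<kappa>': "\<kappa> \<in> \<mu> \<rightarrow>\<^sub>M prob_algebra N"
    using \<kappa> by simp
  have h': "h \<in> borel_measurable (\<mu> \<Otimes>\<^sub>M N)"
    using h by (simp cong: measurable_cong_sets sets_pair_measure_cong)
  have "(\<lambda>x. distr (\<kappa> x) (\<mu> \<Otimes>\<^sub>M N) (Pair x)) \<in> \<mu> \<rightarrow>\<^sub>M prob_algebra (\<mu> \<Otimes>\<^sub>M N)"
    by (rule measurable_distr_prob_space2[OF \<kappa>']) simp
  then have "(\<integral>\<^sup>+ w. h w \<partial>semidirect \<mu> N \<kappa>) =
      (\<integral>\<^sup>+ x. \<integral>\<^sup>+ w. h w \<partial>distr (\<kappa> x) (\<mu> \<Otimes>\<^sub>M N) (Pair x) \<partial>\<mu>)"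
    unfolding semidirect_def
    by (intro nn_integral_bind[OF h'] measurable_prob_algebraD)
  also have "\<dots> = (\<integral>\<^sup>+ x. \<integral>\<^sup>+ y. h (x, y) \<partial>\<kappa> x \<partial>\<mu>)"
  proof (intro nn_integral_cong)
    fix x assume x: "x \<in> space \<mu>"
    then have "sets (\<kappa> x) = sets N"
      using measurable_space[OF \<kappa>'] by (simp add: space_prob_algebra)
    then have "Pair x \<in> \<kappa> x \<rightarrow>\<^sub>M \<mu> \<Otimes>\<^sub>M N"
      using measurable_Pair1'[OF x, of N] by (simp cong: measurable_cong_sets)
    then show "(\<integral>\<^sup>+ w. h w \<partial>distr (\<kappa> x) (\<mu> \<Otimes>\<^sub>M N) (Pair x)) = (\<integral>\<^sup>+ y. h (x, y) \<partial>\<kappa> x)"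
      by (rule nn_integral_distr) (simp add: h')
  qed
  finally show ?thesis .
qed

lemma semidirect_in_prob_algebra:
  assumes \<mu>: "\<mu> \<in> space (prob_algebra L)" and \<kappa>: "\<kappa> \<in> L \<rightarrow>\<^sub>M prob_algebra N"
  shows "semidirect \<mu> N \<kappa> \<in> space (prob_algebra (L \<Otimes>\<^sub>M N))"
proof -
  have s[measurable_cong]: "sets \<mu> = sets L" and p: "prob_space \<mu>"
    using \<mu> by (simp_all add: space_prob_algebra)
  have \<kappa>': "\<kappa> \<in> \<mu> \<rightarrow>\<^sub>M prob_algebra N"
    using \<kappa> by simp
  have m: "(\<lambda>x. distr (\<kappa> x) (\<mu> \<Otimes>\<^sub>M N) (Pair x)) \<in> \<mu> \<rightarrow>\<^sub>M prob_algebra (\<mu> \<Otimes>\<^sub>M N)"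
    by (rule measurable_distr_prob_space2[OF \<kappa>']) simp
  have "\<mu> \<in> space (prob_algebra \<mu>)"
    using p by (simp add: space_prob_algebra)
  from prob_space_bind'[OF this m] sets_bind'[OF this m] s show ?thesis
    unfolding semidirect_def
    by (simp add: space_prob_algebra cong: sets_pair_measure_cong)
qed

definition state_marginal :: "('s::topological_space \<times> 'a) measure \<Rightarrow> 's measure" where
  "state_marginal pD = distr pD borel fst"

definition is_cond_action_law ::
  "('s::topological_space \<times> 'a::metric_space) measure \<Rightarrow> ('s \<Rightarrow> 'a measure) \<Rightarrow> bool" where
  "is_cond_action_law pD pA \<longleftrightarrow>
     pA \<in> borel \<rightarrow>\<^sub>M prob_algebra borel \<and> pD = semidirect (state_marginal pD) borel pA"

definition joint_law ::
  "('s \<times> 'a) measure \<Rightarrow> ('a \<Rightarrow> 's \<Rightarrow> 'z::topological_space measure) \<Rightarrow> (('s \<times> 'a) \<times> 'z) measure" where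
  "joint_law pD q = semidirect pD borel (\<lambda>(s, a). q a s)"

text \<open>The conditional law of \<open>(A, Z)\<close> given \<open>S = s\<close> under \<^const>\<open>joint_law\<close>, namely
  \<open>p\<^sub>D(da | s) q(dz | a, s)\<close>; that it is one is the content of the disintegration lemma below.\<close>

definition cond_law ::
  "('s \<Rightarrow> 'a measure) \<Rightarrow> ('a \<Rightarrow> 's \<Rightarrow> 'z::topological_space measure) \<Rightarrow> 's \<Rightarrow> ('a \<times> 'z) measure" where
  "cond_law pA q s = semidirect (pA s) borel (\<lambda>a. q a s)"

lemma joint_law_disintegration:
  fixes pD :: "('s::topological_space \<times> 'a::metric_space) measure"
    and q :: "'a \<Rightarrow> 's \<Rightarrow> 'z::topological_space measure"
  assumes pD: "pD \<in> space (prob_algebra (borel \<Otimes>\<^sub>M borel))"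
    and pA: "is_cond_action_law pD pA"
    and q: "(\<lambda>(a, s). q a s) \<in> borel \<Otimes>\<^sub>M borel \<rightarrow>\<^sub>M prob_algebra borel"
    and h: "h \<in> borel_measurable (borel \<Otimes>\<^sub>M (borel \<Otimes>\<^sub>M borel))"
  shows "(\<integral>\<^sup>+ ((s, a), z). h (s, (a, z)) \<partial>joint_law pD q) =
         (\<integral>\<^sup>+ s. \<integral>\<^sup>+ w. h (s, w) \<partial>cond_law pA q s \<partial>state_marginal pD)"
proof -
  define pS where "pS = state_marginal pD"
  have pDs[measurable_cong]: "sets pD = sets (borel \<Otimes>\<^sub>M borel)" and pDp: "prob_space pD"
    using pD by (simp_all add: space_prob_algebra)
  have "fst \<in> pD \<rightarrow>\<^sub>M borel" by measurable
  then have pS: "pS \<in> space (prob_algebra borel)"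
    using prob_space.prob_space_distr[OF pDp, of fst borel]
    by (simp add: pS_def state_marginal_def space_prob_algebra)
  have pA'[measurable]: "pA \<in> borel \<rightarrow>\<^sub>M prob_algebra borel" and eq: "pD = semidirect pS borel pA"
    using pA by (auto simp: is_cond_action_law_def pS_def)
  note h[measurable] q[measurable]
  have q': "(\<lambda>w. q (snd w) (fst w)) \<in> borel \<Otimes>\<^sub>M borel \<rightarrow>\<^sub>M prob_algebra borel"
  proof -
    have "(\<lambda>w. (\<lambda>(a, s). q a s) (snd w, fst w)) \<in> borel \<Otimes>\<^sub>M borel \<rightarrow>\<^sub>M prob_algebra borel"
      by (rule measurable_compose[OF _ q]) measurable
    then show ?thesis by simp
  qed
  have qf: "(\<lambda>(s, a). q a s) = (\<lambda>w. q (snd w) (fst w))"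
    by (auto simp: fun_eq_iff)
  have qs: "(\<lambda>a. q a s) \<in> borel \<rightarrow>\<^sub>M prob_algebra borel" for s
    using measurable_compose[OF measurable_Pair2'[of s borel borel] q] by simp
  have H: "(\<lambda>((s, a), z). h (s, (a, z))) \<in> borel_measurable ((borel \<Otimes>\<^sub>M borel) \<Otimes>\<^sub>M borel)"
    unfolding case_prod_beta by measurable
  have "(\<integral>\<^sup>+ ((s, a), z). h (s, (a, z)) \<partial>joint_law pD q) =
        (\<integral>\<^sup>+ w. \<integral>\<^sup>+ z. h (fst w, (snd w, z)) \<partial>q (snd w) (fst w) \<partial>pD)"
    unfolding joint_law_def qf
    by (subst nn_integral_semidirect[OF pD q' H]) (simp add: case_prod_beta)
  also have "\<dots> = (\<integral>\<^sup>+ s. \<integral>\<^sup>+ a. \<integral>\<^sup>+ z. h (s, (a, z)) \<partial>q a s \<partial>pA s \<partial>pS)"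
  proof -
    have "(\<lambda>w. \<integral>\<^sup>+ z. h (fst w, (snd w, z)) \<partial>q (snd w) (fst w)) \<in> borel_measurable (borel \<Otimes>\<^sub>M borel)"
      by (intro nn_integral_measurable_subprob_algebra2[where N=borel]
          measurable_prob_algebraD[OF q']) measurable
    from nn_integral_semidirect[OF pS pA' this] show ?thesis
      by (subst eq) simp
  qed
  also have "\<dots> = (\<integral>\<^sup>+ s. \<integral>\<^sup>+ w. h (s, w) \<partial>cond_law pA q s \<partial>pS)"
  proof (intro nn_integral_cong)
    fix s
    have "pA s \<in> space (prob_algebra borel)"
      using measurable_space[OF pA', of s] by simp
    moreover have "(\<lambda>w. h (s, w)) \<in> borel_measurable (borel \<Otimes>\<^sub>M borel)"
      by measurable
    ultimately show "(\<integral>\<^sup>+ a. \<integral>\<^sup>+ z. h (s, (a, z)) \<partial>q a s \<partial>pA s) = (\<integral>\<^sup>+ w. h (s, w) \<partial>cond_law pA q s)"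
      unfolding cond_law_def by (simp add: nn_integral_semidirect[OF _ qs])
  qed
  finally show ?thesis by (simp add: pS_def)
qed

subsection \<open>Information quantities, in nats\<close>

text \<open>\<open>KL(P \<parallel> Q)\<close> with values in \<open>[0, \<infinity>]\<close>. The library's \<^const>\<open>KL_divergence\<close> takes the
  reference measure first and is real valued, hence meaningless without absolute continuity or
  integrability. As the negative part of the log density is always integrable, failure of
  integrability means that the divergence is infinite.\<close>

definition kl :: "'x measure \<Rightarrow> 'x measure \<Rightarrow> ennreal" where
  "kl P Q =
     (if absolutely_continuous Q P \<and> integrable P (entropy_density (exp 1) Q P)
      then ennreal (KL_divergence (exp 1) Q P) else \<infinity>)"

text \<open>No truncation at \<open>0\<close> takes place in \<^const>\<open>kl\<close>:\<close>

lemma KL_divergence_nonneg_ac: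
  assumes "prob_space P" "prob_space Q" "sets P = sets Q" "absolutely_continuous Q P"
    and int: "integrable P (entropy_density (exp 1) Q P)"
  shows "0 \<le> KL_divergence (exp 1) Q P"
proof -
  interpret P: prob_space P by fact
  interpret Q: prob_space Q by fact
  interpret Q: information_space Q "exp 1" by standard simp
  have "finite_measure P" by unfold_locales
  from Q.real_RN_deriv[OF this assms(4,3)] obtain D
    where D: "D \<in> borel_measurable Q" "AE x in Q. RN_deriv Q P x = ennreal (D x)" "\<And>x. 0 \<le> D x"
    by blast
  have AE_in_P: "AE x in P. RN_deriv Q P x = ennreal (D x)"
    using absolutely_continuous_AE[OF assms(3,4) D(2)] .
  have P_eq: "density Q D = P"
    using D(1,2) Q.density_RN_deriv[OF assms(4,3)]
    by (subst density_cong[of D _ "RN_deriv Q P"]) auto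
  have ae: "AE x in P. log (exp 1) (D x) = entropy_density (exp 1) Q P x"
    using AE_in_P by eventually_elim (simp add: entropy_density_def D(3))
  have DP: "D \<in> borel_measurable P"
    using D(1) assms(3) by (simp cong: measurable_cong_sets)
  have eP: "entropy_density (exp 1) Q P \<in> borel_measurable P"
    using int by (rule borel_measurable_integrable)
  have "integrable P (\<lambda>x. log (exp 1) (D x))"
    using integrable_cong_AE[OF _ eP ae] DP int by simp
  then have "integrable (density Q D) (\<lambda>x. log (exp 1) (D x))"
    by (simp add: P_eq)
  then have "integrable Q (\<lambda>x. D x * log (exp 1) (D x))"
    using D by (subst (asm) integrable_real_density) auto
  then have "0 \<le> KL_divergence (exp 1) Q (density Q D)"
    using D P_eq assms(1) by (intro Q.KL_nonneg) auto
  then show ?thesis by (simp add: P_eq)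
qed

text \<open>\<open>I(X; Y | S)\<close>, where \<open>\<kappa> s\<close> is the conditional law of \<open>(X, Y)\<close> given \<open>S = s\<close>.\<close>

definition cond_mutual_information ::
  "'s measure \<Rightarrow> ('s \<Rightarrow> ('x::topological_space \<times> 'y::topological_space) measure) \<Rightarrow> ennreal" where
  "cond_mutual_information pS \<kappa> =
     (\<integral>\<^sup>+ s. kl (\<kappa> s) (distr (\<kappa> s) borel fst \<Otimes>\<^sub>M distr (\<kappa> s) borel snd) \<partial>pS)"

text \<open>\<^term>\<open>ln (0::real) = 0\<close>, so the convention \<open>0 log 0 = 0\<close> is built in.\<close>

definition binary_entropy :: "real \<Rightarrow> real" where
  "binary_entropy p = - p * ln p - (1 - p) * ln (1 - p)"

subsection \<open>Multimodal structure\<close>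

text \<open>The infimum is taken in \<open>[0, \<infinity>]\<close>, so the distance to the empty set is \<open>\<infinity>\<close> (unlike for
  \<^const>\<open>setdist\<close>).\<close>

definition set_distance :: "'a::metric_space set \<Rightarrow> 'a set \<Rightarrow> ennreal" where
  "set_distance B C = (INF b\<in>B. INF c\<in>C. ennreal (dist b c))"

text \<open>A minimum over finitely many pairs; it is \<open>\<infinity>\<close> if there is only one mode.\<close>

definition mode_gap :: "('s \<Rightarrow> nat) \<Rightarrow> ('s \<Rightarrow> nat \<Rightarrow> 'a::metric_space set) \<Rightarrow> 's \<Rightarrow> ennreal" where
  "mode_gap K C s =
     (INF (k, k') \<in> {(k, k'). k \<in> {1..K s} \<and> k' \<in> {1..K s} \<and> k \<noteq> k'}. set_distance (C s k) (C s k'))"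

definition multimodal_structure ::
  "('s::topological_space \<Rightarrow> 'a::metric_space measure) \<Rightarrow> ('s \<Rightarrow> nat) \<Rightarrow> ('s \<Rightarrow> nat \<Rightarrow> 'a set) \<Rightarrow> bool" where
  "multimodal_structure pA K C \<longleftrightarrow>
     K \<in> borel \<rightarrow>\<^sub>M count_space UNIV \<and>
     (\<forall>k. {(s, a). k \<in> {1..K s} \<and> a \<in> C s k} \<in> sets (borel \<Otimes>\<^sub>M borel)) \<and>
     (\<forall>s. K s \<ge> 1 \<and> msupport (pA s) \<subseteq> (\<Union>k\<in>{1..K s}. C s k) \<and> mode_gap K C s > 0)"

definition mode_label :: "('s \<Rightarrow> nat) \<Rightarrow> ('s \<Rightarrow> nat \<Rightarrow> 'a set) \<Rightarrow> 'a \<Rightarrow> 's \<Rightarrow> nat" where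
  "mode_label K C a s = (\<Sum>k\<in>{1..K s}. k * indicator (C s k) a)"

text \<open>The Shannon entropy of the conditional law of the mode label given \<open>S = s\<close>.\<close>

definition mode_entropy ::
  "('s \<Rightarrow> 'a measure) \<Rightarrow> ('s \<Rightarrow> nat) \<Rightarrow> ('s \<Rightarrow> nat \<Rightarrow> 'a set) \<Rightarrow> 's \<Rightarrow> real" where
  "mode_entropy pA K C s =
     prob_space.entropy (pA s) (exp 1) (count_space UNIV) (\<lambda>a. mode_label K C a s)"

subsection \<open>Mode error and the Fano-corrected bound\<close>

text \<open>The conditional probability given \<open>S = s\<close> that the decoded action misses the mode \<open>C\<^sub>M(s)\<close>.
  Actions outside all modes, which have label \<open>0\<close> and probability \<open>0\<close>, are counted as errors, so
  that the junk set \<open>C s 0\<close> plays no role.\<close>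

definition mode_error ::
  "('s \<Rightarrow> 'a measure) \<Rightarrow> ('a \<Rightarrow> 's \<Rightarrow> 'z::topological_space measure) \<Rightarrow> ('z \<Rightarrow> 's \<Rightarrow> 'a) \<Rightarrow>
   ('s \<Rightarrow> nat) \<Rightarrow> ('s \<Rightarrow> nat \<Rightarrow> 'a set) \<Rightarrow> 's \<Rightarrow> real" where
  "mode_error pA q f K C s =
     Sigma_Algebra.measure (cond_law pA q s)
       {(a, z) \<in> space (cond_law pA q s).
          \<not> (mode_label K C a s \<in> {1..K s} \<and> f z s \<in> C s (mode_label K C a s))}"

definition fano_correction :: "('s \<Rightarrow> nat) \<Rightarrow> ('s \<Rightarrow> real) \<Rightarrow> 's \<Rightarrow> real" where
  "fano_correction K \<rho> s =
     (if K s = 1 then 0 else binary_entropy (\<rho> s) + \<rho> s * ln (real (K s) - 1))"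

definition expected_mode_entropy ::
  "'s measure \<Rightarrow> ('s \<Rightarrow> 'a measure) \<Rightarrow> ('s \<Rightarrow> nat) \<Rightarrow> ('s \<Rightarrow> nat \<Rightarrow> 'a set) \<Rightarrow> ennreal" where
  "expected_mode_entropy pS pA K C = (\<integral>\<^sup>+ s. ennreal (mode_entropy pA K C s) \<partial>pS)"

definition expected_fano_correction ::
  "'s measure \<Rightarrow> ('s \<Rightarrow> nat) \<Rightarrow> ('s \<Rightarrow> real) \<Rightarrow> ennreal" where
  "expected_fano_correction pS K \<rho> = (\<integral>\<^sup>+ s. ennreal (fano_correction K \<rho> s) \<partial>pS)"

text \<open>Both integrands are nonnegative, so the bound makes sense in \<open>[-\<infinity>, \<infinity>]\<close> unless both
  expectations are infinite.\<close>

definition fano_bound_well_defined ::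
  "'s measure \<Rightarrow> ('s \<Rightarrow> 'a measure) \<Rightarrow> ('s \<Rightarrow> nat) \<Rightarrow> ('s \<Rightarrow> nat \<Rightarrow> 'a set) \<Rightarrow> ('s \<Rightarrow> real) \<Rightarrow> bool" where
  "fano_bound_well_defined pS pA K C \<rho> \<longleftrightarrow>
     \<not> (expected_mode_entropy pS pA K C = \<infinity> \<and> expected_fano_correction pS K \<rho> = \<infinity>)"

definition fano_bound ::
  "'s measure \<Rightarrow> ('s \<Rightarrow> 'a measure) \<Rightarrow> ('s \<Rightarrow> nat) \<Rightarrow> ('s \<Rightarrow> nat \<Rightarrow> 'a set) \<Rightarrow> ('s \<Rightarrow> real) \<Rightarrow> ereal" where
  "fano_bound pS pA K C \<rho> =
     enn2ereal (expected_mode_entropy pS pA K C) - enn2ereal (expected_fano_correction pS K \<rho>)"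

end

theory Submission
  imports Defs
begin

text \<open>
  Both bounds come from the variational inequality
  \<open>KL(P \<parallel> Q) \<ge> \<integral> ln w dP + 1 - \<integral> w dQ\<close>, valid for every weight \<open>w \<ge> 0\<close> that is positive
  \<open>P\<close>-almost everywhere. Fix a state and let \<open>w(a, z) = W / p(M)\<close>, where \<open>p\<close> is the law of the
  mode label \<open>M\<close> and \<open>W\<close> is \<open>1 - \<rho>\<close> if \<open>z\<close> is decoded into the mode of \<open>a\<close> and \<open>\<rho> / (K - 1)\<close>
  otherwise. Under the joint law of \<open>(A, Z)\<close> the mean of \<open>ln w\<close> is exactly the mode entropy minus
  the Fano correction, while for every fixed \<open>z\<close> the mean of \<open>w\<close> over \<open>a\<close> is at most \<open>1\<close>, as
  \<open>\<rho> \<le> 1 - 1 / K\<close>. So the integral of \<open>w\<close> against the product of the action law with any law of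
  \<open>z\<close> is at most \<open>1\<close>: the marginal of \<open>Z\<close> gives the bound on the mutual information, and the
  prior, with the inequality applied separately for each \<open>a\<close> and then averaged, gives the other.
\<close>

subsection \<open>Relative entropy\<close>

text \<open>With \<open>D\<close> the density of \<open>P\<close> with respect to \<open>Q\<close>,
  integrate \<open>ln (w / D) \<le> w / D - 1\<close> against \<open>P\<close>. The mean of
  \<open>w / D\<close> under \<open>P\<close> is the \<open>Q\<close>-integral of \<open>w\<close>
  over the set where \<open>D\<close> is positive, hence at most the full integral. If the
  divergence is infinite there is nothing to show.\<close>

lemma gibbs_variational_le_kl:
  fixes w :: "'x \<Rightarrow> real"
  assumes P: "prob_space P" and Q: "prob_space Q" and sets_eq: "sets P = sets Q"
    and nonneg: "\<And>x. 0 \<le> w x" and pos: "AE x in P. 0 < w x"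
    and int_w: "integrable Q w" and int_ln: "integrable P (\<lambda>x. ln (w x))"
  shows "ennreal ((\<integral>x. ln (w x) \<partial>P) + 1 - (\<integral>x. w x \<partial>Q)) \<le> kl P Q"
proof (cases "absolutely_continuous Q P \<and> integrable P (entropy_density (exp 1) Q P)")
  case False
  then show ?thesis by (auto simp: kl_def)
next
  case True
  interpret P: prob_space P by fact
  interpret Q: prob_space Q by fact
  have "finite_measure P" by unfold_locales
  from Q.real_RN_deriv[OF this _ sets_eq] True obtain D
    where D: "D \<in> borel_measurable Q" "AE x in Q. RN_deriv Q P x = ennreal (D x)"
      "AE x in P. 0 < D x" "\<And>x. 0 \<le> D x"
    by blast
  have P_eq: "P = density Q D"
    using D(1,2) Q.density_RN_deriv[of P] True sets_eq
    by (subst density_cong[of D _ "RN_deriv Q P"]) auto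
  have wQ: "w \<in> borel_measurable Q"
    using int_w by (rule borel_measurable_integrable)
  have DP: "D \<in> borel_measurable P" and wP: "w \<in> borel_measurable P"
    using D(1) wQ sets_eq by (simp_all cong: measurable_cong_sets)
  have eP: "entropy_density (exp 1) Q P \<in> borel_measurable P"
    using True by (blast intro: borel_measurable_integrable)
  have ae: "AE x in P. entropy_density (exp 1) Q P x = ln (D x)"
    using absolutely_continuous_AE[OF sets_eq _ D(2)] True
    by (auto simp: entropy_density_def D(4) log_def)
  have lnD: "integrable P (\<lambda>x. ln (D x))"
    using integrable_cong_AE[OF eP _ ae] DP True by simp
  have kl_eq: "KL_divergence (exp 1) Q P = (\<integral>x. ln (D x) \<partial>P)"
    unfolding KL_divergence_def using ae eP DP by (intro integral_cong_AE) auto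
  \<comment> \<open>The integrand is \<open>w x\<close> where \<open>D x\<close> is positive and
    \<open>0\<close> where \<open>D x = 0\<close>, so \<open>w\<close> dominates it.\<close>
  have int_Dw: "integrable Q (\<lambda>x. D x * (w x / D x))"
    by (rule Bochner_Integration.integrable_bound[OF int_w]) (use wQ D(1) nonneg in auto)
  have int_quot: "integrable P (\<lambda>x. w x / D x)"
    unfolding P_eq using int_Dw D wQ by (subst integrable_real_density) auto
  have "(\<integral>x. w x / D x \<partial>P) = (\<integral>x. D x * (w x / D x) \<partial>Q)"
    unfolding P_eq using D wQ by (subst integral_real_density) auto
  also have "\<dots> \<le> (\<integral>x. w x \<partial>Q)"
    by (rule integral_mono[OF int_Dw int_w]) (use nonneg in auto)
  finally have quot_le: "(\<integral>x. w x / D x \<partial>P) \<le> (\<integral>x. w x \<partial>Q)" .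
  have "(\<integral>x. ln (w x) - ln (D x) \<partial>P) \<le> (\<integral>x. w x / D x - 1 \<partial>P)"
  proof (rule integral_mono_AE)
    show "AE x in P. ln (w x) - ln (D x) \<le> w x / D x - 1"
      using pos D(3)
    proof eventually_elim
      case (elim x)
      then show ?case using ln_le_minus_one[of "w x / D x"] by (simp add: ln_div)
    qed
  qed (use int_ln lnD int_quot in auto)
  also have "\<dots> = (\<integral>x. w x / D x \<partial>P) - 1"
    using int_quot by (simp add: P.prob_space)
  finally have "(\<integral>x. ln (w x) \<partial>P) + 1 - (\<integral>x. w x \<partial>Q) \<le> (\<integral>x. ln (D x) \<partial>P)"
    using int_ln lnD quot_le by simp
  then show ?thesis
    using True kl_eq by (simp add: kl_def ennreal_leI)
qed

text \<open>\<open>entropy\<close> integrates over the counting measure on the whole type. The point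
  masses of \<open>X\<close> vanish off \<open>F\<close>, which reduces that integral to a finite
  sum.\<close>

lemma (in prob_space) entropy_finite_range:
  fixes X :: "'a \<Rightarrow> 'b::countable"
  assumes X[measurable]: "X \<in> M \<rightarrow>\<^sub>M count_space UNIV" and F: "finite F" "AE x in M. X x \<in> F"
  shows "entropy (exp 1) (count_space UNIV) X =
    - (\<Sum>k\<in>F. prob {x \<in> space M. X x = k} * ln (prob {x \<in> space M. X x = k}))"
proof -
  interpret information_space M "exp 1" by standard simp
  define p where "p k = prob {x \<in> space M. X x = k}" for k
  have pre: "X -` {k} \<inter> space M = {x \<in> space M. X x = k}" for k by auto
  have "distributed M (count_space UNIV) X p"
    unfolding distributed_def
  proof (intro conjI)
    show "distr M (count_space UNIV) X = density (count_space UNIV) p"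
      by (rule measure_eqI_countable[where A=UNIV])
        (auto simp: emeasure_distr emeasure_density nn_integral_count_space_indicator
          p_def emeasure_eq_measure pre nn_integral_indicator_singleton)
  qed auto
  then have "entropy (exp 1) (count_space UNIV) X = - (\<integral>k. p k * log (exp 1) (p k) \<partial>count_space UNIV)"
    by (rule entropy_distr) (simp add: p_def)
  moreover have out: "p k = 0" if "k \<notin> F" for k
    using F(2) that unfolding p_def by (subst prob_eq_0) auto
  then have "{k \<in> UNIV. p k * log (exp 1) (p k) \<noteq> 0} \<subseteq> F"
    by (auto intro: ccontr)
  then have "(\<integral>k. p k * log (exp 1) (p k) \<partial>count_space UNIV) = (\<Sum>k\<in>F. p k * ln (p k))"
    using F(1) out
    by (subst lebesgue_integral_count_space_finite_support)
      (auto simp: finite_subset log_def intro!: sum.mono_neutral_cong_left)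
  ultimately show ?thesis by (simp add: p_def)
qed

lemma (in prob_space) integral_finite_range:
  fixes g :: "'b::countable \<Rightarrow> real"
  assumes X[measurable]: "X \<in> M \<rightarrow>\<^sub>M count_space UNIV" and F: "finite F" "AE x in M. X x \<in> F"
  shows "(\<integral>x. g (X x) \<partial>M) = (\<Sum>k\<in>F. prob {x \<in> space M. X x = k} * g k)"
proof -
  have "(\<integral>x. g (X x) \<partial>M) = (\<integral>x. (\<Sum>k\<in>F. indicator {x \<in> space M. X x = k} x * g k) \<partial>M)"
  proof (rule integral_cong_AE)
    show "AE x in M. g (X x) = (\<Sum>k\<in>F. indicator {x \<in> space M. X x = k} x * g k)"
      using F(2) AE_space
    proof eventually_elim
      case (elim x)
      then have "(\<Sum>k\<in>F. indicator {x \<in> space M. X x = k} x * g k) = (\<Sum>k\<in>{X x}. g k)"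
        using F(1) by (intro sum.mono_neutral_cong_right) auto
      then show ?case by simp
    qed
  qed measurable
  also have "\<dots> = (\<Sum>k\<in>F. prob {x \<in> space M. X x = k} * g k)"
    by (subst Bochner_Integration.integral_sum) (auto simp: emeasure_eq_measure)
  finally show ?thesis .
qed

subsection \<open>Kernels\<close>

text \<open>Turning an almost-everywhere statement into a vanishing integral makes its dependence on
  \<open>x\<close> measurable and brings it within reach of
  \<open>nn_integral_semidirect\<close>.\<close>

lemma AE_prob_kernel_iff:
  assumes \<kappa>: "\<kappa> \<in> L \<rightarrow>\<^sub>M prob_algebra N" and R: "Measurable.pred (L \<Otimes>\<^sub>M N) R"
    and x: "x \<in> space L"
  shows "(AE y in \<kappa> x. R (x, y)) \<longleftrightarrow>
    (\<integral>\<^sup>+ y. indicator {w \<in> space (L \<Otimes>\<^sub>M N). \<not> R w} (x, y) \<partial>\<kappa> x) = 0"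
proof -
  have sN: "sets (\<kappa> x) = sets N"
    using measurable_space[OF \<kappa> x] by (simp add: space_prob_algebra)
  have "Pair x \<in> N \<rightarrow>\<^sub>M L \<Otimes>\<^sub>M N" using x by (rule measurable_Pair1')
  then have m: "{y \<in> space N. \<not> R (x, y)} \<in> sets N" using R by measurable
  have "(\<integral>\<^sup>+ y. indicator {w \<in> space (L \<Otimes>\<^sub>M N). \<not> R w} (x, y) \<partial>\<kappa> x) =
      (\<integral>\<^sup>+ y. indicator {y \<in> space N. \<not> R (x, y)} y \<partial>\<kappa> x)"
    using x sets_eq_imp_space_eq[OF sN]
    by (intro nn_integral_cong) (auto simp: space_pair_measure indicator_def)
  also have "\<dots> = emeasure (\<kappa> x) {y \<in> space N. \<not> R (x, y)}"
    using m sN by simp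
  finally show ?thesis
    using m sN sets_eq_imp_space_eq[OF sN] by (subst AE_iff_measurable[OF _ refl]) auto
qed

lemma nn_integral_indicator_prob_kernel_measurable:
  assumes \<kappa>: "\<kappa> \<in> L \<rightarrow>\<^sub>M prob_algebra N" and R: "Measurable.pred (L \<Otimes>\<^sub>M N) R"
  shows "(\<lambda>x. \<integral>\<^sup>+ y. indicator {w \<in> space (L \<Otimes>\<^sub>M N). \<not> R w} (x, y) \<partial>\<kappa> x) \<in> borel_measurable L"
  using R by (intro nn_integral_measurable_subprob_algebra2[OF _ measurable_prob_algebraD[OF \<kappa>]]) auto

lemma pred_AE_prob_kernel:
  assumes \<kappa>: "\<kappa> \<in> L \<rightarrow>\<^sub>M prob_algebra N" and R: "Measurable.pred (L \<Otimes>\<^sub>M N) R"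
  shows "Measurable.pred L (\<lambda>x. AE y in \<kappa> x. R (x, y))"
proof -
  note nn_integral_indicator_prob_kernel_measurable[OF assms, measurable]
  have "Measurable.pred L
      (\<lambda>x. (\<integral>\<^sup>+ y. indicator {w \<in> space (L \<Otimes>\<^sub>M N). \<not> R w} (x, y) \<partial>\<kappa> x) = 0)"
    by measurable
  then show ?thesis
    by (rule measurable_cong[THEN iffD1, rotated]) (simp add: AE_prob_kernel_iff[OF assms])
qed

text \<open>Tonelli for null sets: the exceptional set has an iterated integral as its measure, and
  a nonnegative integral vanishes exactly when its integrand vanishes almost everywhere.\<close>

lemma AE_semidirect:
  assumes \<mu>: "\<mu> \<in> space (prob_algebra L)" and \<kappa>: "\<kappa> \<in> L \<rightarrow>\<^sub>M prob_algebra N"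
    and R: "Measurable.pred (L \<Otimes>\<^sub>M N) R"
  shows "(AE w in semidirect \<mu> N \<kappa>. R w) \<longleftrightarrow> (AE x in \<mu>. AE y in \<kappa> x. R (x, y))"
proof -
  note R[measurable]
  have s: "sets (semidirect \<mu> N \<kappa>) = sets (L \<Otimes>\<^sub>M N)"
    using semidirect_in_prob_algebra[OF \<mu> \<kappa>] by (simp add: space_prob_algebra)
  have s\<mu>: "sets \<mu> = sets L" using \<mu> by (simp add: space_prob_algebra)
  have "(AE w in semidirect \<mu> N \<kappa>. R w) \<longleftrightarrow>
      (\<integral>\<^sup>+ w. indicator {w \<in> space (L \<Otimes>\<^sub>M N). \<not> R w} w \<partial>semidirect \<mu> N \<kappa>) = 0"
    using s sets_eq_imp_space_eq[OF s] by (subst AE_iff_measurable[OF _ refl]) (auto)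
  also have "\<dots> \<longleftrightarrow> (\<integral>\<^sup>+ x. \<integral>\<^sup>+ y. indicator {w \<in> space (L \<Otimes>\<^sub>M N). \<not> R w} (x, y) \<partial>\<kappa> x \<partial>\<mu>) = 0"
    by (subst nn_integral_semidirect[OF \<mu> \<kappa>]) auto
  also have "\<dots> \<longleftrightarrow> (AE x in \<mu>. (\<integral>\<^sup>+ y. indicator {w \<in> space (L \<Otimes>\<^sub>M N). \<not> R w} (x, y) \<partial>\<kappa> x) = 0)"
    using nn_integral_indicator_prob_kernel_measurable[OF \<kappa> R]
    by (intro nn_integral_0_iff_AE) (simp add: measurable_cong_sets[OF s\<mu> refl])
  also have "\<dots> \<longleftrightarrow> (AE x in \<mu>. AE y in \<kappa> x. R (x, y))"
    by (intro AE_cong) (simp add: AE_prob_kernel_iff[OF \<kappa> R] sets_eq_imp_space_eq[OF s\<mu>])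
  finally show ?thesis .
qed

text \<open>The signed counterpart of \<open>nn_integral_semidirect\<close>. Boundedness stands in
  for integrability; it is available because the functions integrated later take only finitely many
  values.\<close>

lemma integral_semidirect_bounded:
  fixes h :: "'x \<times> 'y \<Rightarrow> real"
  assumes \<mu>: "\<mu> \<in> space (prob_algebra L)" and \<kappa>: "\<kappa> \<in> L \<rightarrow>\<^sub>M prob_algebra N"
    and h: "h \<in> borel_measurable (L \<Otimes>\<^sub>M N)" and bound: "\<And>w. \<bar>h w\<bar> \<le> B"
  shows "(\<integral>w. h w \<partial>semidirect \<mu> N \<kappa>) = (\<integral>x. \<integral>y. h (x, y) \<partial>\<kappa> x \<partial>\<mu>)"
proof -
  have [measurable_cong]: "sets \<mu> = sets L" and "prob_space \<mu>"
    using \<mu> by (simp_all add: space_prob_algebra)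
  interpret \<mu>: prob_space \<mu> by fact
  have \<kappa>': "\<kappa> \<in> \<mu> \<rightarrow>\<^sub>M prob_algebra N"
    using \<kappa> by simp
  have h': "h \<in> borel_measurable (\<mu> \<Otimes>\<^sub>M N)"
    using h by (simp cong: measurable_cong_sets sets_pair_measure_cong)
  have m: "(\<lambda>x. distr (\<kappa> x) (\<mu> \<Otimes>\<^sub>M N) (Pair x)) \<in> \<mu> \<rightarrow>\<^sub>M prob_algebra (\<mu> \<Otimes>\<^sub>M N)"
    by (rule measurable_distr_prob_space2[OF \<kappa>']) simp
  have "(\<integral>w. h w \<partial>semidirect \<mu> N \<kappa>) =
      (\<integral>x. (\<integral>w. h w \<partial>distr (\<kappa> x) (\<mu> \<Otimes>\<^sub>M N) (Pair x)) \<partial>\<mu>)"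
    unfolding semidirect_def
  \<comment> \<open>\<open>B\<close> bounds the integrand and \<open>B' = 1\<close> the total mass
    of each kernel measure.\<close>
  proof (rule integral_bind[where B=B and B'=1, OF h' _ measurable_prob_algebraD[OF m]])
    show "AE x in \<mu>. emeasure (distr (\<kappa> x) (\<mu> \<Otimes>\<^sub>M N) (Pair x))
        (space (distr (\<kappa> x) (\<mu> \<Otimes>\<^sub>M N) (Pair x))) \<le> ennreal 1"
    proof (rule AE_I2)
      fix x assume "x \<in> space \<mu>"
      then have "prob_space (distr (\<kappa> x) (\<mu> \<Otimes>\<^sub>M N) (Pair x))"
        using measurable_space[OF m] by (simp add: space_prob_algebra)
      then show "emeasure (distr (\<kappa> x) (\<mu> \<Otimes>\<^sub>M N) (Pair x))
          (space (distr (\<kappa> x) (\<mu> \<Otimes>\<^sub>M N) (Pair x))) \<le> ennreal 1"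
        by (simp only: prob_space.emeasure_space_1) simp
    qed
  qed (use bound in \<open>auto intro: \<mu>.finite_measure_axioms\<close>)
  also have "\<dots> = (\<integral>x. \<integral>y. h (x, y) \<partial>\<kappa> x \<partial>\<mu>)"
  proof (intro Bochner_Integration.integral_cong refl)
    fix x assume x: "x \<in> space \<mu>"
    then have "sets (\<kappa> x) = sets N"
      using measurable_space[OF \<kappa>'] by (simp add: space_prob_algebra)
    then have "Pair x \<in> \<kappa> x \<rightarrow>\<^sub>M \<mu> \<Otimes>\<^sub>M N"
      using measurable_Pair1'[OF x, of N] by (simp cong: measurable_cong_sets)
    then show "(\<integral>w. h w \<partial>distr (\<kappa> x) (\<mu> \<Otimes>\<^sub>M N) (Pair x)) = (\<integral>y. h (x, y) \<partial>\<kappa> x)"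
      by (rule integral_distr) (simp add: h')
  qed
  finally show ?thesis .
qed

text \<open>Pushing \<open>\<kappa> x\<close> forward along \<open>Pair x\<close> moves the
  parameter out of the integrand: a fixed function is integrated against a measure that depends
  measurably on \<open>x\<close>.\<close>

lemma integral_measurable_prob_kernel:
  fixes h :: "'x \<times> 'y \<Rightarrow> real"
  assumes h: "h \<in> borel_measurable (L \<Otimes>\<^sub>M N)" and \<kappa>: "\<kappa> \<in> L \<rightarrow>\<^sub>M prob_algebra N"
  shows "(\<lambda>x. \<integral>y. h (x, y) \<partial>\<kappa> x) \<in> borel_measurable L"
proof -
  have "(\<lambda>x. distr (\<kappa> x) (L \<Otimes>\<^sub>M N) (Pair x)) \<in> L \<rightarrow>\<^sub>M subprob_algebra (L \<Otimes>\<^sub>M N)"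
    by (intro measurable_prob_algebraD measurable_distr_prob_space2[OF \<kappa>]) simp
  from measurable_compose[OF this integral_measurable_subprob_algebra[OF h]]
  have "(\<lambda>x. \<integral>w. h w \<partial>distr (\<kappa> x) (L \<Otimes>\<^sub>M N) (Pair x)) \<in> borel_measurable L" .
  moreover have "(\<integral>w. h w \<partial>distr (\<kappa> x) (L \<Otimes>\<^sub>M N) (Pair x)) = (\<integral>y. h (x, y) \<partial>\<kappa> x)"
    if x: "x \<in> space L" for x
  proof -
    have "sets (\<kappa> x) = sets N"
      using measurable_space[OF \<kappa> x] by (simp add: space_prob_algebra)
    then have "Pair x \<in> \<kappa> x \<rightarrow>\<^sub>M L \<Otimes>\<^sub>M N"
      using measurable_Pair1'[OF x, of N] by (simp cong: measurable_cong_sets)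
    then show ?thesis by (rule integral_distr[OF _ h])
  qed
  ultimately show ?thesis by (simp cong: measurable_cong)
qed

subsection \<open>The Fano weight\<close>

definition label_prob :: "'a measure \<Rightarrow> ('a \<Rightarrow> nat) \<Rightarrow> nat \<Rightarrow> real" where
  "label_prob P M k = measure P {a \<in> space P. M a = k}"

text \<open>The conditional law of the label given the decoded mode for which Fano's inequality is an
  equality: the decoded mode is right with probability \<open>1 - r\<close>, and errors are uniform over the
  other \<open>n - 1\<close> labels. The case \<open>n = 1\<close> is separate because of the division by \<open>n - 1\<close>.\<close>

definition fano_weight :: "nat \<Rightarrow> real \<Rightarrow> bool \<Rightarrow> real" where
  "fano_weight n r hit = (if n = 1 then 1 else if hit then 1 - r else r / (real n - 1))"

text \<open>\<open>G k\<close> stands for the latents decoded into mode \<open>k\<close>. The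
  quotient is a likelihood ratio: the label law that makes Fano's inequality tight, given the
  decoded mode, over the prior label law. The default \<open>1\<close> keeps the weight nonnegative
  and its logarithm bounded for every label.\<close>

definition decoding_weight ::
  "'a measure \<Rightarrow> ('a \<Rightarrow> nat) \<Rightarrow> nat \<Rightarrow> (nat \<Rightarrow> 'z set) \<Rightarrow> real \<Rightarrow> 'a \<Rightarrow> 'z \<Rightarrow> real" where
  "decoding_weight P M n G r a z =
     (if M a \<in> {1..n} then fano_weight n r (z \<in> G (M a)) / label_prob P M (M a) else 1)"

lemma fano_weight_nonneg: "1 \<le> n \<Longrightarrow> 0 \<le> r \<Longrightarrow> r \<le> 1 \<Longrightarrow> 0 \<le> fano_weight n r b"
  by (auto simp: fano_weight_def)

text \<open>If \<open>z\<close> decodes to a point outside all modes, the sum is \<open>n r / (n - 1)\<close>; this is where the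
  bound on the error enters.\<close>

lemma sum_fano_weight_le_1:
  assumes "1 \<le> n" "0 \<le> r" and r: "n > 1 \<longrightarrow> r \<le> 1 - 1 / real n"
    and disj: "disjoint_family_on G {1..n}"
  shows "(\<Sum>k\<in>{1..n}. fano_weight n r (z \<in> G k)) \<le> 1"
proof (cases "n = 1")
  case True
  then show ?thesis by (simp add: fano_weight_def)
next
  case False
  then have n: "n > 1" using assms(1) by simp
  show ?thesis
  proof (cases "\<exists>j\<in>{1..n}. z \<in> G j")
    case True
    then obtain j where j: "j \<in> {1..n}" "z \<in> G j" by blast
    \<comment> \<open>By disjointness there is one hit, of weight \<open>1 - r\<close>, and
      \<open>n - 1\<close> misses that share \<open>r\<close>.\<close>
    have "z \<notin> G k" if "k \<in> {1..n}" "k \<noteq> j" for k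
      using disjoint_family_onD[OF disj that(1) j(1) that(2)] j(2) by blast
    then have "(\<Sum>k\<in>{1..n}. fano_weight n r (z \<in> G k)) =
        (1 - r) + (\<Sum>k\<in>{1..n} - {j}. r / (real n - 1))"
      using j n by (subst sum.remove[of _ j]) (auto simp: fano_weight_def intro!: sum.cong)
    also have "\<dots> = 1"
      using j n by (simp add: of_nat_diff)
    finally show ?thesis by simp
  next
    case False
    then have "(\<Sum>k\<in>{1..n}. fano_weight n r (z \<in> G k)) = real n * (r / (real n - 1))"
      using n by (simp add: fano_weight_def)
    also have "\<dots> \<le> real n * ((1 - 1 / real n) / (real n - 1))"
      using n r by (intro mult_left_mono divide_right_mono) auto
    also have "\<dots> = 1"
      using n by (simp add: field_simps)
    finally show ?thesis .
  qed
qed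

text \<open>The situation at one frozen state: \<open>P\<close> is the action law,
  \<open>\<kappa>\<close> the encoder, \<open>M\<close> the mode label and \<open>G k\<close> the
  set of latents decoded into mode \<open>k\<close>.\<close>

locale mode_decoding = P: prob_space P
  for P :: "'a measure" and N :: "'z measure" and \<kappa> :: "'a \<Rightarrow> 'z measure"
    and M :: "'a \<Rightarrow> nat" and n :: nat and G :: "nat \<Rightarrow> 'z set" +
  assumes kernel: "\<kappa> \<in> P \<rightarrow>\<^sub>M prob_algebra N"
    and label[measurable]: "M \<in> P \<rightarrow>\<^sub>M count_space UNIV"
    and label_range: "AE a in P. M a \<in> {1..n}"
    and decoding_sets: "\<And>k. k \<in> {1..n} \<Longrightarrow> G k \<in> sets N"
    and decoding_disjoint: "disjoint_family_on G {1..n}"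
begin

abbreviation joint :: "('a \<times> 'z) measure" where
  "joint \<equiv> semidirect P N \<kappa>"

definition miss_set :: "('a \<times> 'z) set" where
  "miss_set = {(a, z) \<in> space joint. \<not> (M a \<in> {1..n} \<and> z \<in> G (M a))}"

definition miss :: real where
  "miss = measure joint miss_set"

definition label_entropy :: real where
  "label_entropy = - (\<Sum>k\<in>{1..n}. label_prob P M k * ln (label_prob P M k))"

definition fano_term :: real where
  "fano_term = (if n = 1 then 0 else binary_entropy miss + miss * ln (real n - 1))"

abbreviation weight :: "'a \<Rightarrow> 'z \<Rightarrow> real" where
  "weight \<equiv> decoding_weight P M n G miss"

lemma n_ge_1: "1 \<le> n"
proof (rule ccontr)
  assume "\<not> 1 \<le> n"
  then have "AE a in P. False" using label_range by simp
  then show False by (simp add: P.AE_False)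
qed

section \<open>The joint law of action and latent at a fixed state\<close>

lemma P_in_prob_algebra: "P \<in> space (prob_algebra P)"
  by (simp add: space_prob_algebra P.prob_space_axioms)

lemma joint_in_prob_algebra: "joint \<in> space (prob_algebra (P \<Otimes>\<^sub>M N))"
  by (rule semidirect_in_prob_algebra[OF P_in_prob_algebra kernel])

lemma sets_joint[measurable_cong]: "sets joint = sets (P \<Otimes>\<^sub>M N)"
  using joint_in_prob_algebra by (simp add: space_prob_algebra)

lemma space_joint: "space joint = space P \<times> space N"
  using sets_eq_imp_space_eq[OF sets_joint] by (simp add: space_pair_measure)

sublocale joint: prob_space joint
  using joint_in_prob_algebra by (simp add: space_prob_algebra)

text \<open>Labels are countable, so it is enough to treat each fixed label \<open>k\<close>. The
  range condition is part of the event because \<open>G k\<close> is known to be measurable only for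
  \<open>k\<close> in \<open>{1..n}\<close>.\<close>

lemma hit_measurable: "Measurable.pred (P \<Otimes>\<^sub>M N) (\<lambda>w. M (fst w) \<in> {1..n} \<and> snd w \<in> G (M (fst w)))"
proof -
  have "Measurable.pred (P \<Otimes>\<^sub>M N) (\<lambda>w. k \<in> {1..n} \<and> snd w \<in> G k)" for k
    using decoding_sets[of k] by (cases "k \<in> {1..n}") auto
  moreover have "(\<lambda>w. M (fst w)) \<in> P \<Otimes>\<^sub>M N \<rightarrow>\<^sub>M count_space UNIV" by measurable
  ultimately show ?thesis by (rule measurable_compose_countable)
qed

lemma miss_set_eq: "miss_set = {w \<in> space (P \<Otimes>\<^sub>M N). \<not> (M (fst w) \<in> {1..n} \<and> snd w \<in> G (M (fst w)))}"
  by (auto simp: miss_set_def space_joint space_pair_measure)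

lemma sets_miss_set[measurable]: "miss_set \<in> sets (P \<Otimes>\<^sub>M N)"
  unfolding miss_set_eq using hit_measurable by measurable

lemma pred_hit: "(\<lambda>w. w \<notin> miss_set) \<in> joint \<rightarrow>\<^sub>M count_space UNIV"
proof -
  have "{w \<in> space joint. w \<notin> miss_set} = space joint - miss_set" by auto
  also have "\<dots> \<in> sets joint" using sets_miss_set unfolding sets_joint[symmetric] by (rule sets.compl_sets)
  finally show ?thesis unfolding pred_def .
qed

section \<open>Elementary properties and mean of the weight\<close>

lemma miss_bounds: "0 \<le> miss" "miss \<le> 1"
  by (auto simp: miss_def)

lemma weight_nonneg: "0 \<le> weight a z"
  using n_ge_1 miss_bounds by (simp add: decoding_weight_def fano_weight_nonneg label_prob_def)

lemma weight_measurable: "(\<lambda>w. weight (fst w) (snd w)) \<in> borel_measurable (P \<Otimes>\<^sub>M N)"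
proof -
  define g where "g k w = (if k \<in> {1..n} then fano_weight n miss (snd w \<in> G k) / label_prob P M k else 1)"
    for k and w :: "'a \<times> 'z"
  have "g k \<in> borel_measurable (P \<Otimes>\<^sub>M N)" for k
    using decoding_sets[of k] unfolding g_def fano_weight_def by (cases "k \<in> {1..n}") auto
  moreover have "(\<lambda>w. M (fst w)) \<in> P \<Otimes>\<^sub>M N \<rightarrow>\<^sub>M count_space UNIV" by measurable
  ultimately have "(\<lambda>w. g (M (fst w)) w) \<in> borel_measurable (P \<Otimes>\<^sub>M N)"
    by (rule measurable_compose_countable)
  then show ?thesis by (simp add: g_def decoding_weight_def)
qed

text \<open>The weight has finitely many values, so it and its logarithm are bounded; the value
  \<open>0\<close> is harmless since \<open>ln 0 = 0\<close>. All integrability claims below rest on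
  this.\<close>

lemma weight_bounded: obtains B where "\<And>a z. \<bar>weight a z\<bar> \<le> B" "\<And>a z. \<bar>ln (weight a z)\<bar> \<le> B"
proof -
  define S where "S = insert 1 ((\<lambda>(k, b). fano_weight n miss b / label_prob P M k) ` ({1..n} \<times> UNIV))"
  have fin: "finite S" by (simp add: S_def)
  have in_S: "weight a z \<in> S" for a z
    by (auto simp: decoding_weight_def S_def)
  show ?thesis
  proof (rule that)
    fix a z
    show "\<bar>weight a z\<bar> \<le> (\<Sum>x\<in>S. \<bar>x\<bar> + \<bar>ln x\<bar>)" "\<bar>ln (weight a z)\<bar> \<le> (\<Sum>x\<in>S. \<bar>x\<bar> + \<bar>ln x\<bar>)"
      using member_le_sum[OF in_S[of a z], of "\<lambda>x. \<bar>x\<bar> + \<bar>ln x\<bar>"] fin by auto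
  qed
qed

text \<open>The denominator of the weight cancels against the law of the label, which leaves the sum
  bounded in \<open>sum_fano_weight_le_1\<close>.\<close>

lemma integral_weight_label_le_1:
  assumes r: "n > 1 \<longrightarrow> miss \<le> 1 - 1 / real n"
  shows "(\<integral>a. weight a z \<partial>P) \<le> 1"
proof -
  have "(\<integral>a. weight a z \<partial>P) = (\<Sum>k\<in>{1..n}. label_prob P M k *
      (if k \<in> {1..n} then fano_weight n miss (z \<in> G k) / label_prob P M k else 1))"
    unfolding decoding_weight_def
    by (subst P.integral_finite_range[OF label _ label_range]) (simp_all add: label_prob_def)
  \<comment> \<open>Terms agree for labels of positive probability. For a label of probability
    \<open>0\<close> the left term is \<open>0\<close>, the right one nonnegative.\<close>
  also have "\<dots> \<le> (\<Sum>k\<in>{1..n}. fano_weight n miss (z \<in> G k))"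
    using n_ge_1 miss_bounds by (intro sum_mono) (simp add: fano_weight_nonneg)
  also have "\<dots> \<le> 1"
    using n_ge_1 miss_bounds r decoding_disjoint by (intro sum_fano_weight_le_1) auto
  finally show ?thesis .
qed

text \<open>Fubini lets the action be integrated out first, where the bound \<open>1\<close> holds
  for each fixed \<open>z\<close>. The law \<open>\<nu>\<close> of the latent is therefore
  arbitrary, which covers both the marginal of the encoder and the prior.\<close>

lemma integral_weight_le_1:
  assumes r: "n > 1 \<longrightarrow> miss \<le> 1 - 1 / real n"
    and \<nu>: "prob_space \<nu>" "sets \<nu> = sets N"
  shows "integrable (P \<Otimes>\<^sub>M \<nu>) (\<lambda>w. weight (fst w) (snd w))"
    and "(\<integral>w. weight (fst w) (snd w) \<partial>(P \<Otimes>\<^sub>M \<nu>)) \<le> 1"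
    and "(\<integral>a. \<integral>z. weight a z \<partial>\<nu> \<partial>P) \<le> 1"
proof -
  interpret \<nu>: prob_space \<nu> by fact
  interpret P\<nu>: pair_prob_space P \<nu> ..
  note \<nu>(2)[measurable_cong]
  obtain B where B: "\<And>a z. \<bar>weight a z\<bar> \<le> B" "\<And>a z. \<bar>ln (weight a z)\<bar> \<le> B"
    using weight_bounded by blast
  have [measurable]: "(\<lambda>w. weight (fst w) (snd w)) \<in> borel_measurable (P \<Otimes>\<^sub>M \<nu>)"
    using weight_measurable by (simp cong: measurable_cong_sets sets_pair_measure_cong add: \<nu>(2))
  show int: "integrable (P \<Otimes>\<^sub>M \<nu>) (\<lambda>w. weight (fst w) (snd w))"
    by (rule P\<nu>.integrable_const_bound[where B=B]) (auto simp: B)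
  have "(\<integral>w. weight (fst w) (snd w) \<partial>(P \<Otimes>\<^sub>M \<nu>)) = (\<integral>z. \<integral>a. weight a z \<partial>P \<partial>\<nu>)"
    using P\<nu>.integral_snd[of "\<lambda>a z. weight a z"] int by (simp add: case_prod_beta')
  also have "\<dots> \<le> 1"
  proof (rule \<nu>.integral_le_const)
    show "integrable \<nu> (\<lambda>z. \<integral>a. weight a z \<partial>P)"
      using P\<nu>.integrable_snd[of "\<lambda>a z. weight a z"] int by (simp add: case_prod_beta')
  qed (simp add: integral_weight_label_le_1[OF r])
  finally show le: "(\<integral>w. weight (fst w) (snd w) \<partial>(P \<Otimes>\<^sub>M \<nu>)) \<le> 1" .
  show "(\<integral>a. \<integral>z. weight a z \<partial>\<nu> \<partial>P) \<le> 1"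
    using P\<nu>.integral_fst'[OF int] le by simp
qed

section \<open>Almost sure positivity of the weight\<close>

lemma AE_label_prob_pos: "AE a in P. 0 < label_prob P M (M a)"
proof -
  have "AE a in P. \<forall>k\<in>{1..n}. M a = k \<longrightarrow> 0 < label_prob P M k"
  proof (rule AE_finite_allI)
    fix k
    show "AE a in P. M a = k \<longrightarrow> 0 < label_prob P M k"
    proof (cases "label_prob P M k = 0")
      case True
      then have "AE a in P. M a \<noteq> k"
        unfolding label_prob_def by (subst (asm) P.prob_eq_0) auto
      then show ?thesis by eventually_elim simp
    next
      case False
      then have "0 < label_prob P M k" by (simp add: label_prob_def less_le)
      then show ?thesis by simp
    qed
  qed simp
  then show ?thesis using label_range by eventually_elim auto
qed

lemma AE_joint_fst:
  assumes "AE a in P. R a" "Measurable.pred P R"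
  shows "AE w in joint. R (fst w)"
proof -
  have "Measurable.pred (P \<Otimes>\<^sub>M N) (\<lambda>w. R (fst w))" using assms(2) by measurable
  then show ?thesis
    using assms(1) by (subst AE_semidirect[OF P_in_prob_algebra kernel]) auto
qed

lemma AE_joint_label_range: "AE w in joint. M (fst w) \<in> {1..n}"
  by (rule AE_joint_fst[OF label_range]) (rule measurable_compose[OF label, of "\<lambda>k. k \<in> {1..n}"], simp)

text \<open>The weight of a hit could vanish only for \<open>miss = 1\<close>, which the error bound
  excludes. The weight of a miss vanishes only for \<open>miss = 0\<close>, and then misses form a
  null set.\<close>

lemma AE_fano_weight_pos:
  assumes r: "n > 1 \<longrightarrow> miss \<le> 1 - 1 / real n"
  shows "AE w in joint. 0 < fano_weight n miss (w \<notin> miss_set)"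
proof (cases "n = 1")
  case True
  then show ?thesis by (simp add: fano_weight_def)
next
  case False
  then have n: "n > 1" using n_ge_1 by simp
  have "1 - 1 / real n < 1" using n by simp
  then have "miss < 1" using r n by linarith
  show ?thesis
  proof (cases "miss = 0")
    case True
    then have "AE w in joint. w \<notin> miss_set"
      using joint.prob_eq_0[of miss_set] by (simp add: miss_def sets_joint)
    then show ?thesis by eventually_elim (use \<open>miss < 1\<close> n in \<open>simp add: fano_weight_def\<close>)
  next
    case False
    then have "0 < miss" using miss_bounds by simp
    then show ?thesis using \<open>miss < 1\<close> n by (simp add: fano_weight_def)
  qed
qed

lemma AE_weight_eq:
  "AE w in joint. weight (fst w) (snd w) =
     fano_weight n miss (w \<notin> miss_set) / label_prob P M (M (fst w))"
  using AE_joint_label_range AE_space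
  by eventually_elim (auto simp: decoding_weight_def miss_set_def)

lemma AE_joint_label_prob_pos: "AE w in joint. 0 < label_prob P M (M (fst w))"
  by (rule AE_joint_fst[OF AE_label_prob_pos]) (rule measurable_compose[OF label, of "\<lambda>k. 0 < label_prob P M k"], simp)

lemma AE_weight_pos:
  assumes r: "n > 1 \<longrightarrow> miss \<le> 1 - 1 / real n"
  shows "AE w in joint. 0 < weight (fst w) (snd w)"
  using AE_weight_eq AE_fano_weight_pos[OF r] AE_joint_label_prob_pos
  by eventually_elim simp

section \<open>The mean of the logarithm of the weight\<close>

lemma integral_ln_fano_weight:
  "(\<integral>w. ln (fano_weight n miss (w \<notin> miss_set)) \<partial>joint) = - fano_term"
proof (cases "n = 1")
  case True
  then show ?thesis unfolding fano_weight_def fano_term_def by simp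
next
  case False
  then have n: "n > 1" using n_ge_1 by simp
  \<comment> \<open>The integrand has two values, so it is affine in the indicator of
    \<open>miss_set\<close>, whose mean is \<open>miss\<close>.\<close>
  have "(\<integral>w. ln (fano_weight n miss (w \<notin> miss_set)) \<partial>joint) =
      (\<integral>w. ln (1 - miss) + indicator miss_set w * (ln (miss / (real n - 1)) - ln (1 - miss)) \<partial>joint)"
    using n by (intro Bochner_Integration.integral_cong) (auto simp: fano_weight_def)
  also have "\<dots> = ln (1 - miss) + miss * (ln (miss / (real n - 1)) - ln (1 - miss))"
    by (simp add: joint.prob_space miss_def sets_joint joint.emeasure_eq_measure)
  \<comment> \<open>The logarithm of the quotient is split with \<open>ln_div\<close> only for
    positive \<open>miss\<close>; at \<open>miss = 0\<close> its coefficient is zero.\<close>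
  also have "\<dots> = - fano_term"
    using n miss_bounds
    by (cases "miss = 0") (auto simp: fano_term_def binary_entropy_def ln_div algebra_simps)
  finally show ?thesis .
qed

lemma label_function_measurable:
  "(\<lambda>a. h (M a)) \<in> borel_measurable P" "(\<lambda>w. h (M (fst w))) \<in> borel_measurable joint"
  for h :: "nat \<Rightarrow> real"
proof -
  show 1: "(\<lambda>a. h (M a)) \<in> borel_measurable P"
    by (rule measurable_compose[OF label, of h]) simp
  show "(\<lambda>w. h (M (fst w))) \<in> borel_measurable joint"
    unfolding measurable_cong_sets[OF sets_joint refl]
    by (rule measurable_compose[OF measurable_fst 1])
qed

lemma integral_label_joint:
  fixes h :: "nat \<Rightarrow> real"
  shows "(\<integral>w. h (M (fst w)) \<partial>joint) = (\<Sum>k\<in>{1..n}. label_prob P M k * h k)"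
proof -
  \<comment> \<open>Cutting \<open>h\<close> off outside \<open>{1..n}\<close> changes it on a null
    set of labels and gives the bounded function that \<open>integral_semidirect_bounded\<close>
    asks for.\<close>
  define g where "g k = (if k \<in> {1..n} then h k else 0)" for k
  have bound: "\<bar>g k\<bar> \<le> (\<Sum>k\<in>{1..n}. \<bar>h k\<bar>)" for k
    using member_le_sum[of k "{1..n}" "\<lambda>k. \<bar>h k\<bar>"] by (auto simp: g_def intro: sum_nonneg)
  have m: "(\<lambda>w. g (M (fst w))) \<in> borel_measurable (P \<Otimes>\<^sub>M N)"
    using label_function_measurable(2)[of g] unfolding measurable_cong_sets[OF sets_joint refl] .
  have "(\<integral>w. h (M (fst w)) \<partial>joint) = (\<integral>w. g (M (fst w)) \<partial>joint)"
    by (rule integral_cong_AE[OF label_function_measurable(2) label_function_measurable(2)])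
      (use AE_joint_label_range in eventually_elim, simp add: g_def)
  also have "\<dots> = (\<integral>a. \<integral>z. g (M a) \<partial>\<kappa> a \<partial>P)"
    using integral_semidirect_bounded[OF P_in_prob_algebra kernel m bound] by simp
  also have "\<dots> = (\<integral>a. g (M a) \<partial>P)"
  proof (intro Bochner_Integration.integral_cong refl)
    fix a assume "a \<in> space P"
    then interpret K: prob_space "\<kappa> a"
      using measurable_space[OF kernel] by (simp add: space_prob_algebra)
    show "(\<integral>z. g (M a) \<partial>\<kappa> a) = g (M a)"
      by (simp add: K.prob_space)
  qed
  also have "\<dots> = (\<Sum>k\<in>{1..n}. label_prob P M k * g k)"
    unfolding label_prob_def by (rule P.integral_finite_range[OF label _ label_range]) simp
  finally show ?thesis by (simp add: g_def)
qed

text \<open>The logarithm of the weight splits almost everywhere, both factors being positive there.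
  The Fano factor has log mean \<open>- fano_term\<close>; the label probability has log mean
  \<open>- label_entropy\<close>.\<close>

lemma integral_ln_weight:
  assumes r: "n > 1 \<longrightarrow> miss \<le> 1 - 1 / real n"
  shows "integrable joint (\<lambda>w. ln (weight (fst w) (snd w)))"
    and "(\<integral>w. ln (weight (fst w) (snd w)) \<partial>joint) = label_entropy - fano_term"
proof -
  let ?w = "\<lambda>w. ln (weight (fst w) (snd w))"
  let ?f = "\<lambda>w. ln (fano_weight n miss (w \<notin> miss_set))"
  let ?l = "\<lambda>w. ln (label_prob P M (M (fst w)))"
  have "(\<lambda>w. weight (fst w) (snd w)) \<in> borel_measurable joint"
    unfolding measurable_cong_sets[OF sets_joint refl] by (rule weight_measurable)
  then have w_m: "?w \<in> borel_measurable joint"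
    by (rule measurable_compose) simp
  obtain B where B: "\<And>a z. \<bar>weight a z\<bar> \<le> B" "\<And>a z. \<bar>ln (weight a z)\<bar> \<le> B"
    using weight_bounded by blast
  show int: "integrable joint ?w"
    by (rule joint.integrable_const_bound[OF _ w_m, where B=B]) (simp add: B)
  have f_m: "?f \<in> borel_measurable joint"
    by (rule measurable_compose[OF pred_hit]) simp
  have f_int: "integrable joint ?f"
  proof (rule joint.integrable_const_bound[OF _ f_m])
    show "AE w in joint. norm (?f w) \<le>
        max \<bar>ln (fano_weight n miss True)\<bar> \<bar>ln (fano_weight n miss False)\<bar>"
      by (rule AE_I2) (case_tac "w \<in> miss_set"; simp)
  qed
  have ae: "AE w in joint. ?w w = ?f w - ?l w"
    using AE_weight_eq AE_fano_weight_pos[OF r] AE_joint_label_prob_pos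
    by eventually_elim (simp add: ln_div)
  note l_m = label_function_measurable(2)[of "\<lambda>k. ln (label_prob P M k)"]
  \<comment> \<open>Integrability of \<open>?l\<close> is inherited from the bounded functions
    \<open>?f\<close> and \<open>?w\<close>, whose difference it is.\<close>
  have ae_l: "AE w in joint. ?f w - ?w w = ?l w"
    using ae by eventually_elim simp
  have l_int: "integrable joint ?l"
    by (rule integrable_cong_AE_imp[OF Bochner_Integration.integrable_diff[OF f_int int] l_m ae_l])
  have l_eq: "(\<integral>w. ?l w \<partial>joint) = - label_entropy"
    unfolding label_entropy_def minus_minus by (rule integral_label_joint)
  have "(\<integral>w. ?w w \<partial>joint) = (\<integral>w. ?f w - ?l w \<partial>joint)"
    by (rule integral_cong_AE[OF w_m _ ae]) (intro borel_measurable_diff f_m l_m)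
  also have "\<dots> = (\<integral>w. ?f w \<partial>joint) - (\<integral>w. ?l w \<partial>joint)"
    by (rule Bochner_Integration.integral_diff[OF f_int l_int])
  also have "\<dots> = label_entropy - fano_term"
    by (simp only: l_eq integral_ln_fano_weight)
  finally show "(\<integral>w. ?w w \<partial>joint) = label_entropy - fano_term" .
qed

section \<open>Divergence bounds at a fixed state\<close>

lemma fano_le_kl_joint:
  assumes r: "n > 1 \<longrightarrow> miss \<le> 1 - 1 / real n"
    and \<nu>: "prob_space \<nu>" "sets \<nu> = sets N"
  shows "ennreal (label_entropy - fano_term) \<le> kl joint (P \<Otimes>\<^sub>M \<nu>)"
proof -
  interpret \<nu>: prob_space \<nu> by fact
  interpret P\<nu>: pair_prob_space P \<nu> ..
  note W = integral_weight_le_1[OF r \<nu>] and L = integral_ln_weight[OF r]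
  \<comment> \<open>By \<open>W(2)\<close> the correction \<open>1 - \<integral> w\<close> in the
    variational inequality is nonnegative, so it may be added.\<close>
  have "ennreal (label_entropy - fano_term) \<le>
      ennreal ((\<integral>w. ln (weight (fst w) (snd w)) \<partial>joint) + 1
        - (\<integral>w. weight (fst w) (snd w) \<partial>(P \<Otimes>\<^sub>M \<nu>)))"
    using W(2) L(2) by (intro ennreal_leI) simp
  also have "\<dots> \<le> kl joint (P \<Otimes>\<^sub>M \<nu>)"
  proof (rule gibbs_variational_le_kl)
    show "sets joint = sets (P \<Otimes>\<^sub>M \<nu>)"
      by (simp add: sets_joint \<nu>(2) cong: sets_pair_measure_cong)
  qed (use AE_weight_pos[OF r] W(1) L(1) weight_nonneg in
      \<open>auto intro: joint.prob_space_axioms P\<nu>.prob_space_axioms\<close>)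
  finally show ?thesis .
qed

text \<open>\<open>a \<mapsto> kl (\<kappa> a) \<nu>\<close> is not known to be measurable, so its integral is only a lower integral;
  it is bounded below through this measurable minorant.\<close>

definition kl_minorant :: "'z measure \<Rightarrow> 'a \<Rightarrow> real" where
  "kl_minorant \<nu> a = (\<integral>z. ln (weight a z) \<partial>\<kappa> a) + 1 - (\<integral>z. weight a z \<partial>\<nu>)"

lemma AE_kernel_weight_pos:
  assumes r: "n > 1 \<longrightarrow> miss \<le> 1 - 1 / real n"
  shows "AE a in P. AE z in \<kappa> a. 0 < weight a z"
  using AE_weight_pos[OF r] weight_measurable
  by (subst (asm) AE_semidirect[OF P_in_prob_algebra kernel]) auto

lemma kl_minorant_le:
  assumes a: "a \<in> space P" and pos: "AE z in \<kappa> a. 0 < weight a z"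
    and \<nu>: "prob_space \<nu>" "sets \<nu> = sets N"
  shows "ennreal (kl_minorant \<nu> a) \<le> kl (\<kappa> a) \<nu>"
proof -
  interpret \<nu>: prob_space \<nu> by fact
  obtain B where B: "\<And>a z. \<bar>weight a z\<bar> \<le> B" "\<And>a z. \<bar>ln (weight a z)\<bar> \<le> B"
    using weight_bounded by blast
  have K: "prob_space (\<kappa> a)" "sets (\<kappa> a) = sets N"
    using measurable_space[OF kernel a] by (auto simp: space_prob_algebra)
  interpret K: prob_space "\<kappa> a" by fact
  have m: "(\<lambda>z. weight a z) \<in> borel_measurable N"
    using measurable_compose[OF measurable_Pair1'[OF a] weight_measurable] by simp
  have [measurable]: "(\<lambda>z. weight a z) \<in> borel_measurable \<nu>"
    "(\<lambda>z. weight a z) \<in> borel_measurable (\<kappa> a)"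
    using m K(2) \<nu>(2) by (simp_all cong: measurable_cong_sets)
  show ?thesis unfolding kl_minorant_def
  proof (rule gibbs_variational_le_kl)
    show "integrable \<nu> (weight a)"
      by (rule \<nu>.integrable_const_bound[where B=B]) (auto simp: B)
    show "integrable (\<kappa> a) (\<lambda>z. ln (weight a z))"
      by (rule K.integrable_const_bound[where B=B]) (auto simp: B)
  qed (use K \<nu> pos weight_nonneg in auto)
qed

text \<open>At a single action the correction in \<open>kl_minorant\<close> may be negative;
  averaged over \<open>P\<close> it is nonnegative by the last part of
  \<open>integral_weight_le_1\<close>. The averaged logarithm is the mean under the joint
  law.\<close>

lemma fano_le_integral_kl_minorant:
  assumes r: "n > 1 \<longrightarrow> miss \<le> 1 - 1 / real n"
    and \<nu>: "prob_space \<nu>" "sets \<nu> = sets N"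
  shows "ennreal (label_entropy - fano_term) \<le> (\<integral>\<^sup>+ a. ennreal (kl_minorant \<nu> a) \<partial>P)"
proof -
  interpret \<nu>: prob_space \<nu> by fact
  interpret P\<nu>: pair_prob_space P \<nu> ..
  obtain B where B: "\<And>a z. \<bar>weight a z\<bar> \<le> B" "\<And>a z. \<bar>ln (weight a z)\<bar> \<le> B"
    using weight_bounded by blast
  note W = integral_weight_le_1[OF r \<nu>]
  have lnm: "(\<lambda>w. ln (weight (fst w) (snd w))) \<in> borel_measurable (P \<Otimes>\<^sub>M N)"
    using weight_measurable by measurable
  have int1: "integrable P (\<lambda>a. \<integral>z. ln (weight a z) \<partial>\<kappa> a)"
  proof (rule P.integrable_const_bound[where B=B])
    show "(\<lambda>a. \<integral>z. ln (weight a z) \<partial>\<kappa> a) \<in> borel_measurable P"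
      using integral_measurable_prob_kernel[OF lnm kernel] by simp
    show "AE a in P. norm (\<integral>z. ln (weight a z) \<partial>\<kappa> a) \<le> B"
    proof (rule AE_I2)
      fix a assume "a \<in> space P"
      then interpret K: prob_space "\<kappa> a"
        using measurable_space[OF kernel] by (simp add: space_prob_algebra)
      have "norm (\<integral>z. ln (weight a z) \<partial>\<kappa> a) \<le> (\<integral>z. norm (ln (weight a z)) \<partial>\<kappa> a)"
        by (rule integral_norm_bound)
      also have "\<dots> \<le> (\<integral>z. B \<partial>\<kappa> a)"
        by (rule integral_mono') (use B B(2)[THEN order_trans[OF abs_ge_zero]] in auto)
      finally show "norm (\<integral>z. ln (weight a z) \<partial>\<kappa> a) \<le> B"
        by (simp add: K.prob_space)
    qed
  qed
  have int2: "integrable P (\<lambda>a. \<integral>z. weight a z \<partial>\<nu>)"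
    using P\<nu>.integrable_fst'[OF W(1)] by simp
  have int: "integrable P (kl_minorant \<nu>)"
    unfolding kl_minorant_def using int1 int2 by auto
  have eq: "(\<integral>a. \<integral>z. ln (weight a z) \<partial>\<kappa> a \<partial>P) = label_entropy - fano_term"
    using integral_semidirect_bounded[OF P_in_prob_algebra kernel lnm, of B] B(2) integral_ln_weight(2)[OF r]
    by simp
  have "label_entropy - fano_term \<le> (\<integral>a. kl_minorant \<nu> a \<partial>P)"
    unfolding kl_minorant_def using int1 int2 eq W(3) by (simp add: P.prob_space)
  \<comment> \<open>\<open>ennreal\<close> truncates negative values to \<open>0\<close>, and
    passing to the positive part only increases the integral.\<close>
  also have "\<dots> \<le> (\<integral>a. max 0 (kl_minorant \<nu> a) \<partial>P)"
    using int by (intro integral_mono) auto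
  finally have "ennreal (label_entropy - fano_term) \<le> ennreal (\<integral>a. max 0 (kl_minorant \<nu> a) \<partial>P)"
    by (rule ennreal_leI)
  also have "\<dots> = (\<integral>\<^sup>+ a. ennreal (max 0 (kl_minorant \<nu> a)) \<partial>P)"
    using int by (subst nn_integral_eq_integral) auto
  also have "\<dots> = (\<integral>\<^sup>+ a. ennreal (kl_minorant \<nu> a) \<partial>P)"
    by (intro nn_integral_cong) (simp add: max_def ennreal_neg)
  finally show ?thesis .
qed

end

subsection \<open>Modes and the Fano-corrected bound\<close>

text \<open>A common point has distance \<open>0\<close> to itself, which would force the gap down
  to \<open>0\<close>.\<close>

lemma mode_gap_pos_imp_disjoint:
  assumes gap: "mode_gap K C s > 0" and k: "k \<in> {1..K s}" "k' \<in> {1..K s}" "k \<noteq> k'"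
  shows "C s k \<inter> C s k' = {}"
proof (rule ccontr)
  assume "C s k \<inter> C s k' \<noteq> {}"
  then obtain a where a: "a \<in> C s k" "a \<in> C s k'" by blast
  have "mode_gap K C s \<le> set_distance (C s k) (C s k')"
    unfolding mode_gap_def using k by (intro INF_lower2[of "(k, k')"]) auto
  also have "\<dots> \<le> ennreal (dist a a)"
    unfolding set_distance_def using a by (intro INF_lower2[OF a(1)] INF_lower2[OF a(2)]) auto
  finally show False using gap by simp
qed

text \<open>Since \<open>h\<close> is at most the positive part of \<open>h - g\<close> plus
  \<open>g\<close>, the integral of \<open>h\<close> is at most \<open>X\<close> plus that of
  \<open>g\<close>. A finite integral of \<open>g\<close> can be subtracted; if it is infinite,
  \<open>fin\<close> makes the left side \<open>-\<infinity>\<close>.\<close>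

lemma ereal_diff_le_of_nn_integral_diff_le:
  assumes [measurable]: "h \<in> borel_measurable \<mu>" "g \<in> borel_measurable \<mu>"
    and g: "\<And>x. 0 \<le> g x"
    and fin: "\<not> ((\<integral>\<^sup>+ x. ennreal (h x) \<partial>\<mu>) = \<infinity> \<and> (\<integral>\<^sup>+ x. ennreal (g x) \<partial>\<mu>) = \<infinity>)"
    and le: "(\<integral>\<^sup>+ x. ennreal (h x - g x) \<partial>\<mu>) \<le> X"
  shows "enn2ereal (\<integral>\<^sup>+ x. ennreal (h x) \<partial>\<mu>) - enn2ereal (\<integral>\<^sup>+ x. ennreal (g x) \<partial>\<mu>) \<le> enn2ereal X"
proof -
  let ?H = "\<integral>\<^sup>+ x. ennreal (h x) \<partial>\<mu>" and ?G = "\<integral>\<^sup>+ x. ennreal (g x) \<partial>\<mu>"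
  have "?H \<le> (\<integral>\<^sup>+ x. ennreal (h x - g x) + ennreal (g x) \<partial>\<mu>)"
  proof (intro nn_integral_mono)
    fix x
    show "ennreal (h x) \<le> ennreal (h x - g x) + ennreal (g x)"
      using g[of x] by (cases "g x \<le> h x") (auto simp: ennreal_plus[symmetric] ennreal_neg ennreal_leI
          simp del: ennreal_plus)
  qed
  also have "\<dots> = (\<integral>\<^sup>+ x. ennreal (h x - g x) \<partial>\<mu>) + ?G"
    by (rule nn_integral_add) auto
  also have "\<dots> \<le> X + ?G" using le by (rule add_right_mono)
  finally have "enn2ereal ?H \<le> enn2ereal X + enn2ereal ?G"
    by (simp add: less_eq_ennreal.rep_eq plus_ennreal.rep_eq)
  moreover have "\<not> (enn2ereal ?H = \<infinity> \<and> enn2ereal ?G = \<infinity>)"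
    using fin by (metis enn2ereal_top top_ennreal.rep_eq enn2ereal_inject infinity_ennreal_def)
  ultimately show ?thesis
    using enn2ereal_nonneg[of ?H] enn2ereal_nonneg[of ?G] enn2ereal_nonneg[of X]
    by (cases "enn2ereal ?H"; cases "enn2ereal ?G"; cases "enn2ereal X") auto
qed

lemma binary_entropy_nonneg:
  assumes "0 \<le> p" "p \<le> 1"
  shows "0 \<le> binary_entropy p"
proof -
  have "x * ln x \<le> 0" if "0 \<le> x" "x \<le> 1" for x :: real
    using that by (cases "x = 0") (auto intro: mult_nonneg_nonpos)
  from this[of p] this[of "1 - p"] assms show ?thesis
    by (simp add: binary_entropy_def)
qed

lemma fano_correction_nonneg:
  assumes "0 \<le> \<rho> s" "\<rho> s \<le> 1" "1 \<le> K s"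
  shows "0 \<le> fano_correction K \<rho> s"
  using assms binary_entropy_nonneg[of "\<rho> s"] by (auto simp: fano_correction_def)

locale multimodal_policy =
  fixes pD :: "('s::topological_space \<times> 'a::metric_space) measure"
    and pA :: "'s \<Rightarrow> 'a measure"
    and K :: "'s \<Rightarrow> nat"
    and C :: "'s \<Rightarrow> nat \<Rightarrow> 'a set"
    and q :: "'a \<Rightarrow> 's \<Rightarrow> 'z::topological_space measure"
    and f :: "'z \<Rightarrow> 's \<Rightarrow> 'a"
  assumes pD: "pD \<in> space (prob_algebra (borel \<Otimes>\<^sub>M borel))"
    and action_law: "is_cond_action_law pD pA"
    and action_support: "\<forall>s. carried_by_support (pA s)"
    and modes: "multimodal_structure pA K C"
    and encoder: "(\<lambda>(a, s). q a s) \<in> borel \<Otimes>\<^sub>M borel \<rightarrow>\<^sub>M prob_algebra borel"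
    and decoder: "(\<lambda>(z, s). f z s) \<in> borel \<Otimes>\<^sub>M borel \<rightarrow>\<^sub>M borel"
begin

abbreviation label :: "'s \<Rightarrow> 'a \<Rightarrow> nat" where
  "label s \<equiv> \<lambda>a. mode_label K C a s"

abbreviation decoded_mode :: "'s \<Rightarrow> nat \<Rightarrow> 'z set" where
  "decoded_mode s k \<equiv> {z. f z s \<in> C s k}"

abbreviation \<rho> :: "'s \<Rightarrow> real" where
  "\<rho> \<equiv> mode_error pA q f K C"

section \<open>Measurability of labels and decoding\<close>

lemma K_measurable[measurable]: "K \<in> borel \<rightarrow>\<^sub>M count_space UNIV"
  and mode_sets: "{(s, a). k \<in> {1..K s} \<and> a \<in> C s k} \<in> sets (borel \<Otimes>\<^sub>M borel)"
  and K_ge_1: "1 \<le> K s"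
  and support_subset: "msupport (pA s) \<subseteq> (\<Union>k\<in>{1..K s}. C s k)"
  using modes by (auto simp: multimodal_structure_def)

lemma pA_measurable: "pA \<in> borel \<rightarrow>\<^sub>M prob_algebra borel"
  and pD_eq: "pD = semidirect (state_marginal pD) borel pA"
  using action_law by (auto simp: is_cond_action_law_def)

lemma pA_in: "pA s \<in> space (prob_algebra borel)"
  using measurable_space[OF pA_measurable] by simp

lemma sets_pA: "sets (pA s) = sets borel"
  and prob_space_pA: "prob_space (pA s)"
  using pA_in[of s] by (simp_all add: space_prob_algebra)

lemma space_pA[simp]: "space (pA s) = UNIV"
  using sets_eq_imp_space_eq[OF sets_pA] by simp

lemma state_marginal_in: "state_marginal pD \<in> space (prob_algebra borel)"
proof -
  have [measurable_cong]: "sets pD = sets (borel \<Otimes>\<^sub>M borel)" and p: "prob_space pD"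
    using pD by (simp_all add: space_prob_algebra)
  have "fst \<in> pD \<rightarrow>\<^sub>M borel" by measurable
  then show ?thesis
    using prob_space.prob_space_distr[OF p, of fst borel]
    by (simp add: state_marginal_def space_prob_algebra)
qed

lemma sets_state_marginal: "sets (state_marginal pD) = sets borel"
  using state_marginal_in by (simp add: space_prob_algebra)

lemma encoder_swap: "(\<lambda>w. q (snd w) (fst w)) \<in> borel \<Otimes>\<^sub>M borel \<rightarrow>\<^sub>M prob_algebra borel"
proof -
  have "(\<lambda>w. (\<lambda>(a, s). q a s) (snd w, fst w)) \<in> borel \<Otimes>\<^sub>M borel \<rightarrow>\<^sub>M prob_algebra borel"
    by (rule measurable_compose[OF _ encoder]) measurable
  then show ?thesis by simp
qed

lemma encoder_section: "(\<lambda>a. q a s) \<in> borel \<rightarrow>\<^sub>M prob_algebra borel"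
  using measurable_compose[OF measurable_Pair2'[of s borel borel] encoder] by simp

lemma pred_mode: "Measurable.pred (borel \<Otimes>\<^sub>M borel) (\<lambda>w. k \<in> {1..K (fst w)} \<and> snd w \<in> C (fst w) k)"
  unfolding pred_def using mode_sets[of k] by (simp add: case_prod_beta' space_pair_measure)

text \<open>Disjoint modes leave at most one nonzero term in the sum defining the label. The label
  \<open>0\<close> marks the points outside all modes, hence \<open>k \<noteq> 0\<close>.\<close>

lemma label_eq_iff:
  assumes "k \<noteq> 0"
  shows "label s a = k \<longleftrightarrow> k \<in> {1..K s} \<and> a \<in> C s k"
proof -
  have in_mode: "label s a = j" if "j \<in> {1..K s}" "a \<in> C s j" for j
  proof -
    have gap: "mode_gap K C s > 0"
      using modes by (simp add: multimodal_structure_def)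
    have "a \<notin> C s i" if "i \<in> {1..K s}" "i \<noteq> j" for i
      using mode_gap_pos_imp_disjoint[OF gap that(1) \<open>j \<in> {1..K s}\<close> that(2)] \<open>a \<in> C s j\<close> by blast
    then have "label s a = (\<Sum>i\<in>{j}. i * indicator (C s i) a)"
      unfolding mode_label_def using that(1) by (intro sum.mono_neutral_right) auto
    then show ?thesis using that by simp
  qed
  show ?thesis
  proof
    assume *: "label s a = k"
    then have "label s a \<noteq> 0" using assms by simp
    then obtain j where "j \<in> {1..K s}" "a \<in> C s j"
      unfolding mode_label_def by (auto simp: indicator_def split: if_splits)
    with in_mode[OF this] * show "k \<in> {1..K s} \<and> a \<in> C s k" by simp
  qed (use in_mode in blast)
qed

text \<open>The preimage of a nonzero label is a mode set. The preimage of \<open>0\<close> is the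
  complement of the countable union of all the others.\<close>

lemma label_measurable: "(\<lambda>w. label (fst w) (snd w)) \<in> borel \<Otimes>\<^sub>M borel \<rightarrow>\<^sub>M count_space UNIV"
proof -
  have pos: "Measurable.pred (borel \<Otimes>\<^sub>M borel) (\<lambda>w. label (fst w) (snd w) = k)" if "k \<noteq> 0" for k
    using pred_mode[of k] by (simp only: label_eq_iff[OF that])
  have "Measurable.pred (borel \<Otimes>\<^sub>M borel) (\<lambda>w. \<forall>k. k \<noteq> 0 \<longrightarrow> \<not> label (fst w) (snd w) = k)"
    by (intro pred_intros_countable pred_intros_imp' pred_intros_logic pos)
  moreover have "(\<forall>k. k \<noteq> 0 \<longrightarrow> \<not> m = k) \<longleftrightarrow> m = 0" for m :: nat by auto
  ultimately have zero: "Measurable.pred (borel \<Otimes>\<^sub>M borel) (\<lambda>w. label (fst w) (snd w) = 0)"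
    by (simp only:)
  have "Measurable.pred (borel \<Otimes>\<^sub>M borel) (\<lambda>w. label (fst w) (snd w) = k)" for k
    by (cases "k = 0") (simp_all only: zero pos not_False_eq_True)
  then have "{w \<in> space (borel \<Otimes>\<^sub>M borel). label (fst w) (snd w) = k} \<in> sets (borel \<Otimes>\<^sub>M borel)" for k
    unfolding pred_def .
  moreover have "(\<lambda>w. label (fst w) (snd w)) -` {k} \<inter> space (borel \<Otimes>\<^sub>M borel) =
      {w \<in> space (borel \<Otimes>\<^sub>M borel). label (fst w) (snd w) = k}" for k by auto
  ultimately show ?thesis
    by (subst measurable_count_space_eq2_countable) simp_all
qed

lemma label_section_measurable: "label s \<in> borel \<rightarrow>\<^sub>M count_space UNIV"
  using measurable_compose[OF measurable_Pair1'[of s borel borel] label_measurable] by simp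

lemma decoder_swap: "(\<lambda>w. f (snd w) (fst w)) \<in> borel \<Otimes>\<^sub>M borel \<rightarrow>\<^sub>M borel"
proof -
  have "(\<lambda>w. (\<lambda>(z, s). f z s) (snd w, fst w)) \<in> borel \<Otimes>\<^sub>M borel \<rightarrow>\<^sub>M borel"
    by (rule measurable_compose[OF _ decoder]) measurable
  then show ?thesis by simp
qed

lemma pred_decoded_mode:
  "Measurable.pred (borel \<Otimes>\<^sub>M borel) (\<lambda>w. k \<in> {1..K (fst w)} \<and> snd w \<in> decoded_mode (fst w) k)"
proof -
  have "(\<lambda>w. (fst w, f (snd w) (fst w))) \<in> borel \<Otimes>\<^sub>M borel \<rightarrow>\<^sub>M borel \<Otimes>\<^sub>M borel"
    using decoder_swap by measurable
  from measurable_compose[OF this pred_mode[of k]] show ?thesis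
    by (simp only: fst_conv snd_conv mem_Collect_eq)
qed

section \<open>Conditioning on the state\<close>

sublocale cond: mode_decoding "pA s" borel "\<lambda>a. q a s" "label s" "K s" "decoded_mode s" for s
proof -
  interpret A: prob_space "pA s" by (rule prob_space_pA)
  show "mode_decoding (pA s) borel (\<lambda>a. q a s) (label s) (K s) (decoded_mode s)"
  proof
    show "(\<lambda>a. q a s) \<in> pA s \<rightarrow>\<^sub>M prob_algebra borel"
      unfolding measurable_cong_sets[OF sets_pA refl] by (rule encoder_section)
    show "label s \<in> pA s \<rightarrow>\<^sub>M count_space UNIV"
      unfolding measurable_cong_sets[OF sets_pA refl] by (rule label_section_measurable)
    \<comment> \<open>The modes are only known to cover the support; that the support carries the
      law makes the label almost surely valid.\<close>
    have "AE a in pA s. a \<in> msupport (pA s)"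
      using action_support by (simp add: carried_by_support_def)
    then show "AE a in pA s. label s a \<in> {1..K s}"
    proof eventually_elim
      case (elim a)
      then obtain k where "k \<in> {1..K s}" "a \<in> C s k" using support_subset[of s] by blast
      with label_eq_iff[of k a s] show ?case by auto
    qed
    show "decoded_mode s k \<in> sets borel" if "k \<in> {1..K s}" for k
    proof -
      have "Measurable.pred borel (\<lambda>z. k \<in> {1..K s} \<and> z \<in> decoded_mode s k)"
        using measurable_compose[OF measurable_Pair1'[of s borel borel] pred_decoded_mode[of k]]
        by (simp only: fst_conv snd_conv space_borel UNIV_I)
      then have "{z \<in> space borel. k \<in> {1..K s} \<and> z \<in> decoded_mode s k} \<in> sets borel"
        unfolding pred_def .
      moreover have "{z \<in> space borel. k \<in> {1..K s} \<and> z \<in> decoded_mode s k} = decoded_mode s k"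
        using that by auto
      ultimately show ?thesis by (simp only:)
    qed
    show "disjoint_family_on (decoded_mode s) {1..K s}"
      unfolding disjoint_family_on_def
    proof (intro ballI impI)
      fix k k' assume k: "k \<in> {1..K s}" "k' \<in> {1..K s}" "k \<noteq> k'"
      have "mode_gap K C s > 0"
        using modes by (simp add: multimodal_structure_def)
      from mode_gap_pos_imp_disjoint[where C=C, OF this k]
      show "decoded_mode s k \<inter> decoded_mode s k' = {}" by blast
    qed
  qed
qed

lemma cond_miss: "cond.miss s = \<rho> s"
  unfolding cond.miss_def cond.miss_set_def mode_error_def cond_law_def by simp

lemma \<rho>_bounds: "0 \<le> \<rho> s" "\<rho> s \<le> 1"
  using cond.miss_bounds[of s] by (simp_all add: cond_miss)

lemma cond_label_entropy: "cond.label_entropy s = mode_entropy pA K C s"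
  unfolding cond.label_entropy_def mode_entropy_def label_prob_def
  by (subst cond.P.entropy_finite_range[OF cond.label _ cond.label_range]) simp_all

lemma cond_fano_term: "cond.fano_term s = fano_correction K \<rho> s"
  unfolding cond.fano_term_def fano_correction_def cond_miss by simp

subsection \<open>Measurability in the state\<close>

lemma label_prob_measurable:
  "(\<lambda>s. label_prob (pA s) (label s) k) \<in> borel_measurable borel"
proof -
  have "(SIGMA s:space borel. {a. label s a = k}) = {w \<in> space (borel \<Otimes>\<^sub>M borel). label (fst w) (snd w) = k}"
    by (auto simp: space_pair_measure)
  also have "\<dots> \<in> sets (borel \<Otimes>\<^sub>M borel)"
    using label_measurable by measurable
  finally show ?thesis
    unfolding label_prob_def
    using measure_measurable_subprob_algebra2[OF _ measurable_prob_algebraD[OF pA_measurable]] by simp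
qed

lemma mode_entropy_measurable: "mode_entropy pA K C \<in> borel_measurable borel"
proof -
  \<comment> \<open>The number of summands varies with the state. With this number fixed at
    \<open>m\<close> the sum is measurable, and \<open>K\<close> selects among countably many such
    functions.\<close>
  define g where
    "g m s = - (\<Sum>k\<in>{1..m}. label_prob (pA s) (label s) k * ln (label_prob (pA s) (label s) k))" for m s
  have "g m \<in> borel_measurable borel" for m
    unfolding g_def using label_prob_measurable by measurable
  then have "(\<lambda>s. g (K s) s) \<in> borel_measurable borel"
    using K_measurable by (rule measurable_compose_countable)
  moreover have "mode_entropy pA K C = (\<lambda>s. g (K s) s)"
    by (simp add: fun_eq_iff g_def cond.label_entropy_def cond_label_entropy[symmetric])
  ultimately show ?thesis by (simp only:)
qed

lemma pred_hit: "Measurable.pred ((borel \<Otimes>\<^sub>M borel) \<Otimes>\<^sub>M borel)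
  (\<lambda>w. label (fst (fst w)) (snd (fst w)) \<in> {1..K (fst (fst w))} \<and>
     snd w \<in> decoded_mode (fst (fst w)) (label (fst (fst w)) (snd (fst w))))"
proof -
  have "(\<lambda>w. (fst (fst w), snd w)) \<in> (borel \<Otimes>\<^sub>M borel) \<Otimes>\<^sub>M borel \<rightarrow>\<^sub>M borel \<Otimes>\<^sub>M borel"
    by measurable
  from measurable_compose[OF this pred_decoded_mode]
  have "Measurable.pred ((borel \<Otimes>\<^sub>M borel) \<Otimes>\<^sub>M borel)
      (\<lambda>w. k \<in> {1..K (fst (fst w))} \<and> snd w \<in> decoded_mode (fst (fst w)) k)" for k
    by (simp only: fst_conv snd_conv)
  moreover have "(\<lambda>w. label (fst (fst w)) (snd (fst w))) \<in> (borel \<Otimes>\<^sub>M borel) \<Otimes>\<^sub>M borel \<rightarrow>\<^sub>M count_space UNIV"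
    by (rule measurable_compose[OF measurable_fst label_measurable])
  ultimately show ?thesis by (rule measurable_compose_countable)
qed

lemma cond_law_measurable: "cond_law pA q \<in> borel \<rightarrow>\<^sub>M prob_algebra (borel \<Otimes>\<^sub>M borel)"
proof -
  have "(\<lambda>s. pA s \<bind> (\<lambda>a. distr (q a s) (borel \<Otimes>\<^sub>M borel) (Pair a)))
      \<in> borel \<rightarrow>\<^sub>M prob_algebra (borel \<Otimes>\<^sub>M borel)"
  proof (rule measurable_bind_prob_space2[OF pA_measurable])
    have "(\<lambda>w. distr (q (snd w) (fst w)) (borel \<Otimes>\<^sub>M borel) (Pair (snd w)))
        \<in> borel \<Otimes>\<^sub>M borel \<rightarrow>\<^sub>M prob_algebra (borel \<Otimes>\<^sub>M borel)"
      by (rule measurable_distr_prob_space2[OF encoder_swap]) measurable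
    then show "(\<lambda>(s, a). distr (q a s) (borel \<Otimes>\<^sub>M borel) (Pair a))
        \<in> borel \<Otimes>\<^sub>M borel \<rightarrow>\<^sub>M prob_algebra (borel \<Otimes>\<^sub>M borel)"
      by (simp add: case_prod_beta')
  qed
  \<comment> \<open>\<open>semidirect\<close> forms the product with \<open>pA s\<close>, which
    varies with \<open>s\<close>; only its sigma-algebra matters, and that is constantly the Borel
    one.\<close>
  moreover have "distr (q a s) (pA s \<Otimes>\<^sub>M borel) (Pair a) = distr (q a s) (borel \<Otimes>\<^sub>M borel) (Pair a)" for a s
    by (intro distr_cong sets_pair_measure_cong sets_pA refl)
  ultimately show ?thesis
    by (simp add: cond_law_def[abs_def] semidirect_def)
qed

lemma space_cond_law: "space (cond_law pA q s) = UNIV"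
  using measurable_space[OF cond_law_measurable, of s]
  by (auto simp: space_prob_algebra space_pair_measure dest: sets_eq_imp_space_eq)

lemma \<rho>_measurable: "\<rho> \<in> borel_measurable borel"
proof -
  \<comment> \<open>The sets \<open>X s\<close> are the sections of one measurable set, so the
    measurability of the kernel \<open>cond_law pA q\<close> carries over to their measures.\<close>
  define X where "X s = {w. \<not> (label s (fst w) \<in> {1..K s} \<and> snd w \<in> decoded_mode s (label s (fst w)))}" for s
  have "(\<lambda>w. ((fst w, fst (snd w)), snd (snd w))) \<in>
      borel \<Otimes>\<^sub>M (borel \<Otimes>\<^sub>M borel) \<rightarrow>\<^sub>M (borel \<Otimes>\<^sub>M borel) \<Otimes>\<^sub>M borel"
    by measurable
  from measurable_compose[OF this pred_hit]
  have "Measurable.pred (borel \<Otimes>\<^sub>M (borel \<Otimes>\<^sub>M borel)) (\<lambda>w. snd w \<in> X (fst w))"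
    unfolding X_def mem_Collect_eq fst_conv snd_conv by (rule pred_intros_logic)
  then have "{w \<in> space (borel \<Otimes>\<^sub>M (borel \<Otimes>\<^sub>M borel)). snd w \<in> X (fst w)} \<in> sets (borel \<Otimes>\<^sub>M (borel \<Otimes>\<^sub>M borel))"
    unfolding pred_def .
  moreover have "{w \<in> space (borel \<Otimes>\<^sub>M (borel \<Otimes>\<^sub>M borel)). snd w \<in> X (fst w)} = Sigma (space borel) X"
    by (auto simp: space_pair_measure)
  ultimately have "(\<lambda>s. measure (cond_law pA q s) (X s)) \<in> borel_measurable borel"
    using measure_measurable_subprob_algebra2[OF _ measurable_prob_algebraD[OF cond_law_measurable], of X]
    by simp
  moreover have "\<rho> s = measure (cond_law pA q s) (X s)" for s
    unfolding mode_error_def space_cond_law by (rule arg_cong[where f="measure _"]) (auto simp: X_def)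
  ultimately show ?thesis by (simp cong: measurable_cong)
qed

lemma fano_correction_measurable: "fano_correction K \<rho> \<in> borel_measurable borel"
  unfolding fano_correction_def[abs_def] binary_entropy_def
  using \<rho>_measurable by measurable

text \<open>Within \<open>cond\<close> the weight is measurable for each fixed state. Joint
  measurability in state, action and latent is what integration over \<open>pD\<close> calls
  for.\<close>

lemma weight_measurable:
  "(\<lambda>w. decoding_weight (pA (fst (fst w))) (label (fst (fst w))) (K (fst (fst w)))
      (decoded_mode (fst (fst w))) (\<rho> (fst (fst w))) (snd (fst w)) (snd w))
    \<in> borel_measurable ((borel \<Otimes>\<^sub>M borel) \<Otimes>\<^sub>M borel)"
proof -
  let ?B = "(borel \<Otimes>\<^sub>M borel) \<Otimes>\<^sub>M borel :: (('s \<times> 'a) \<times> 'z) measure"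
  have s: "(\<lambda>w. fst (fst w)) \<in> ?B \<rightarrow>\<^sub>M borel" by measurable
  have l[measurable]: "(\<lambda>w. label (fst (fst w)) (snd (fst w))) \<in> ?B \<rightarrow>\<^sub>M count_space UNIV"
    by (rule measurable_compose[OF measurable_fst label_measurable])
  have K[measurable]: "(\<lambda>w. K (fst (fst w))) \<in> ?B \<rightarrow>\<^sub>M count_space UNIV"
    by (rule measurable_compose[OF s K_measurable])
  have r[measurable]: "(\<lambda>w. \<rho> (fst (fst w))) \<in> borel_measurable ?B"
    by (rule measurable_compose[OF s \<rho>_measurable])
  have p[measurable]: "(\<lambda>w. label_prob (pA (fst (fst w))) (label (fst (fst w))) (label (fst (fst w)) (snd (fst w))))
      \<in> borel_measurable ?B"
    by (rule measurable_compose_countable[OF measurable_compose[OF s label_prob_measurable] l])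
  note pred_hit[measurable]
  \<comment> \<open>The range condition is repeated inside the hit event, matching
    \<open>pred_hit\<close>; within this branch it is true anyway.\<close>
  have "(\<lambda>w. if label (fst (fst w)) (snd (fst w)) \<in> {1..K (fst (fst w))} then
      fano_weight (K (fst (fst w))) (\<rho> (fst (fst w)))
        (label (fst (fst w)) (snd (fst w)) \<in> {1..K (fst (fst w))} \<and>
         snd w \<in> decoded_mode (fst (fst w)) (label (fst (fst w)) (snd (fst w))))
      / label_prob (pA (fst (fst w))) (label (fst (fst w))) (label (fst (fst w)) (snd (fst w))) else 1)
    \<in> borel_measurable ?B"
    unfolding fano_weight_def by measurable
  then show ?thesis
    by (rule measurable_cong[THEN iffD1, rotated]) (simp add: decoding_weight_def)
qed

subsection \<open>The two lower bounds\<close>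

context
  assumes marginal_support: "carried_by_support (state_marginal pD)"
    and error_bound: "\<forall>s \<in> msupport (state_marginal pD). K s > 1 \<longrightarrow> \<rho> s \<le> 1 - 1 / real (K s)"
begin

lemma AE_error_bound: "AE s in state_marginal pD. K s > 1 \<longrightarrow> \<rho> s \<le> 1 - 1 / real (K s)"
  using marginal_support unfolding carried_by_support_def
  by eventually_elim (use error_bound in blast)

lemma fano_le_cond_mutual_information:
  "(\<integral>\<^sup>+ s. ennreal (mode_entropy pA K C s - fano_correction K \<rho> s) \<partial>state_marginal pD)
    \<le> cond_mutual_information (state_marginal pD) (cond_law pA q)"
  unfolding cond_mutual_information_def
proof (rule nn_integral_mono_AE)
  show "AE s in state_marginal pD. ennreal (mode_entropy pA K C s - fano_correction K \<rho> s)
    \<le> kl (cond_law pA q s) (distr (cond_law pA q s) borel fst \<Otimes>\<^sub>M distr (cond_law pA q s) borel snd)"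
    using AE_error_bound
  proof eventually_elim
    case (elim s)
    have sets_c: "sets (cond_law pA q s) = sets (borel \<Otimes>\<^sub>M borel)" and pc: "prob_space (cond_law pA q s)"
      using measurable_space[OF cond_law_measurable, of s] by (auto simp: space_prob_algebra)
    note sets_c[measurable_cong]
    \<comment> \<open>The mutual information refers to the product of the two marginals. Identifying
      the first with \<open>pA s\<close> lets \<open>cond.fano_le_kl_joint\<close> apply, with
      \<open>\<nu>\<close> the second.\<close>
    have "distr (cond_law pA q s) borel fst = pA s"
    proof (rule measure_eqI)
      fix X assume X: "X \<in> sets (distr (cond_law pA q s) borel fst)"
      then have [measurable]: "X \<in> sets borel" by simp
      have "emeasure (distr (cond_law pA q s) borel fst) X =
          (\<integral>\<^sup>+ a. indicator X a \<partial>distr (cond_law pA q s) borel fst)"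
        by simp
      also have "\<dots> = (\<integral>\<^sup>+ w. indicator X (fst w) \<partial>cond_law pA q s)"
        by (rule nn_integral_distr) measurable
      also have "\<dots> = (\<integral>\<^sup>+ a. \<integral>\<^sup>+ z. indicator X a \<partial>q a s \<partial>pA s)"
        unfolding cond_law_def by (subst nn_integral_semidirect[OF pA_in encoder_section]) auto
      also have "\<dots> = (\<integral>\<^sup>+ a. indicator X a \<partial>pA s)"
      proof (intro nn_integral_cong)
        fix a
        interpret Q: prob_space "q a s"
          using measurable_space[OF encoder_section[of s], of a] by (simp add: space_prob_algebra)
        show "(\<integral>\<^sup>+ z. indicator X a \<partial>q a s) = indicator X a"
          by (simp add: Q.emeasure_space_1)
      qed
      also have "\<dots> = emeasure (pA s) X"
        by (rule nn_integral_indicator) (simp add: sets_pA)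
      finally show "emeasure (distr (cond_law pA q s) borel fst) X = emeasure (pA s) X" .
    qed (simp add: sets_pA)
    moreover have "prob_space (distr (cond_law pA q s) borel snd)"
      by (rule prob_space.prob_space_distr[OF pc]) measurable
    ultimately show ?case
      using cond.fano_le_kl_joint[of s "distr (cond_law pA q s) borel snd"] elim
      by (simp add: cond_law_def[symmetric] cond_miss cond_label_entropy cond_fano_term)
  qed
qed

text \<open>The measurable minorant \<open>h\<close> passes from the iterated integral to one over
  \<open>pD\<close>; the divergence itself enters only at the end, by monotonicity.\<close>

lemma fano_le_expected_kl:
  assumes prior: "p \<in> borel \<rightarrow>\<^sub>M prob_algebra borel"
  shows "(\<integral>\<^sup>+ s. ennreal (mode_entropy pA K C s - fano_correction K \<rho> s) \<partial>state_marginal pD)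
    \<le> (\<integral>\<^sup>+ (s, a). kl (q a s) (p s) \<partial>pD)"
proof -
  have p: "prob_space (p s)" "sets (p s) = sets borel" for s
    using measurable_space[OF prior, of s] by (auto simp: space_prob_algebra)
  define W where "W w = decoding_weight (pA (fst (fst w))) (label (fst (fst w))) (K (fst (fst w)))
      (decoded_mode (fst (fst w))) (\<rho> (fst (fst w))) (snd (fst w)) (snd w)" for w
  have W: "W \<in> borel_measurable ((borel \<Otimes>\<^sub>M borel) \<Otimes>\<^sub>M borel)"
    unfolding W_def[abs_def] by (rule weight_measurable)
  define h where "h w = ennreal (cond.kl_minorant (fst w) (p (fst w)) (snd w))" for w
  have prior': "(\<lambda>w. p (fst w)) \<in> borel \<Otimes>\<^sub>M borel \<rightarrow>\<^sub>M prob_algebra borel"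
    by (rule measurable_compose[OF measurable_fst prior])
  have h: "h \<in> borel_measurable (borel \<Otimes>\<^sub>M borel)"
  proof -
    have "(\<lambda>w. ln (W w)) \<in> borel_measurable ((borel \<Otimes>\<^sub>M borel) \<Otimes>\<^sub>M borel)"
      using W by measurable
    from integral_measurable_prob_kernel[OF this encoder_swap] integral_measurable_prob_kernel[OF W prior']
    have "(\<lambda>w. ennreal ((\<integral>z. ln (W (w, z)) \<partial>q (snd w) (fst w)) + 1 - (\<integral>z. W (w, z) \<partial>p (fst w))))
        \<in> borel_measurable (borel \<Otimes>\<^sub>M borel)"
      by measurable
    then show ?thesis
      by (simp add: h_def[abs_def] cond.kl_minorant_def W_def cond_miss)
  qed
  have pred_W: "Measurable.pred ((borel \<Otimes>\<^sub>M borel) \<Otimes>\<^sub>M borel) (\<lambda>w. 0 < W w)"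
    using W by measurable
  have "AE s in state_marginal pD. AE a in pA s. AE z in q a s. 0 < W ((s, a), z)"
    using AE_error_bound
  proof eventually_elim
    case (elim s)
    then show ?case
      using cond.AE_kernel_weight_pos[of s] by (simp add: W_def cond_miss)
  qed
  \<comment> \<open>The minorant inequality is wanted for \<open>pD\<close>-almost every pair, so
    positivity is carried from the disintegration to \<open>pD\<close>;
    \<open>pred_AE_prob_kernel\<close> makes the inner statement a measurable event.\<close>
  then have "AE w in semidirect (state_marginal pD) borel pA. AE z in q (snd w) (fst w). 0 < W (w, z)"
    by (subst AE_semidirect[OF state_marginal_in pA_measurable
          pred_AE_prob_kernel[OF encoder_swap pred_W]]) (simp only: fst_conv snd_conv)
  then have "AE w in pD. AE z in q (snd w) (fst w). 0 < W (w, z)"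
    unfolding pD_eq[symmetric] .
  then have le: "AE w in pD. h w \<le> (case w of (s, a) \<Rightarrow> kl (q a s) (p s))"
  proof eventually_elim
    case (elim w)
    then show ?case
      using cond.kl_minorant_le[of "snd w" "fst w" "p (fst w)"] p
      by (simp add: h_def W_def cond_miss case_prod_beta')
  qed
  have "(\<integral>\<^sup>+ s. ennreal (mode_entropy pA K C s - fano_correction K \<rho> s) \<partial>state_marginal pD)
      \<le> (\<integral>\<^sup>+ s. \<integral>\<^sup>+ a. h (s, a) \<partial>pA s \<partial>state_marginal pD)"
  proof (rule nn_integral_mono_AE)
    show "AE s in state_marginal pD. ennreal (mode_entropy pA K C s - fano_correction K \<rho> s)
        \<le> (\<integral>\<^sup>+ a. h (s, a) \<partial>pA s)"
      using AE_error_bound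
    proof eventually_elim
      case (elim s)
      then show ?case
        using cond.fano_le_integral_kl_minorant[of s "p s"] p
        by (simp add: h_def cond_miss cond_label_entropy cond_fano_term)
    qed
  qed
  also have "\<dots> = (\<integral>\<^sup>+ w. h w \<partial>pD)"
    by (subst (2) pD_eq) (rule nn_integral_semidirect[OF state_marginal_in pA_measurable h, symmetric])
  also have "\<dots> \<le> (\<integral>\<^sup>+ (s, a). kl (q a s) (p s) \<partial>pD)"
    by (rule nn_integral_mono_AE[OF le])
  finally show ?thesis .
qed

end

text \<open>The statewise bounds control the integral of a truncated difference; this converts them
  into the difference of two expectations.\<close>

lemma fano_bound_le:
  assumes "fano_bound_well_defined (state_marginal pD) pA K C \<rho>"
    and "(\<integral>\<^sup>+ s. ennreal (mode_entropy pA K C s - fano_correction K \<rho> s) \<partial>state_marginal pD) \<le> X"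
  shows "fano_bound (state_marginal pD) pA K C \<rho> \<le> enn2ereal X"
  unfolding fano_bound_def expected_mode_entropy_def expected_fano_correction_def
proof (rule ereal_diff_le_of_nn_integral_diff_le)
  show "mode_entropy pA K C \<in> borel_measurable (state_marginal pD)"
    unfolding measurable_cong_sets[OF sets_state_marginal refl] by (rule mode_entropy_measurable)
  show "fano_correction K \<rho> \<in> borel_measurable (state_marginal pD)"
    unfolding measurable_cong_sets[OF sets_state_marginal refl] by (rule fano_correction_measurable)
  show "0 \<le> fano_correction K \<rho> s" for s
    using \<rho>_bounds K_ge_1 by (rule fano_correction_nonneg)
qed (use assms in \<open>auto simp: fano_bound_well_defined_def expected_mode_entropy_def
      expected_fano_correction_def\<close>)

end

theorem proposition1:
  fixes pD :: "('s::topological_space \<times> 'a::metric_space) measure"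
    and pA :: "'s \<Rightarrow> 'a measure"
    and K :: "'s \<Rightarrow> nat"
    and C :: "'s \<Rightarrow> nat \<Rightarrow> 'a set"
    and q :: "'a \<Rightarrow> 's \<Rightarrow> (real ^ 'd) measure"
    and p\<psi> :: "'s \<Rightarrow> (real ^ 'd) measure"
    and f :: "real ^ 'd \<Rightarrow> 's \<Rightarrow> 'a"
  defines "pS \<equiv> state_marginal pD"
    and "\<rho> \<equiv> mode_error pA q f K C"
  assumes "pD \<in> space (prob_algebra (borel \<Otimes>\<^sub>M borel))"
    and "is_cond_action_law pD pA"
    and "carried_by_support pS"
    and "\<forall>s. carried_by_support (pA s)"
    and "multimodal_structure pA K C"
    and "(\<lambda>(a, s). q a s) \<in> borel \<Otimes>\<^sub>M borel \<rightarrow>\<^sub>M prob_algebra borel"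
    and "p\<psi> \<in> borel \<rightarrow>\<^sub>M prob_algebra borel"
    and "(\<lambda>(z, s). f z s) \<in> borel \<Otimes>\<^sub>M borel \<rightarrow>\<^sub>M borel"
    and "\<forall>s \<in> msupport pS. K s > 1 \<longrightarrow> \<rho> s \<le> 1 - 1 / real (K s)"
    and "fano_bound_well_defined pS pA K C \<rho>"
  shows "enn2ereal (cond_mutual_information pS (cond_law pA q)) \<ge> fano_bound pS pA K C \<rho>
       \<and> enn2ereal (\<integral>\<^sup>+ (s, a). kl (q a s) (p\<psi> s) \<partial>pD) \<ge> fano_bound pS pA K C \<rho>"
proof -
  interpret multimodal_policy pD pA K C q f
    using assms by unfold_locales auto
  \<comment> \<open>Both claims are instances of \<open>fano_bound_le\<close>, with \<open>X\<close>
    the mutual information and the expected divergence.\<close>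
  show ?thesis
    unfolding pS_def \<rho>_def
    using assms(3-) fano_le_cond_mutual_information fano_le_expected_kl[of p\<psi>]
    by (intro conjI fano_bound_le) (simp_all add: pS_def \<rho>_def)
qed

end
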